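(* For each integer $\beta \geq 5$, the groups \[ \Gamma^{2^{\beta-1}, 2^{\beta}}(-1 + 2^{\beta-2},\ -3 + 2^{\beta-2},\ 1 - 2^{\beta-2},\ 3 + 2^{\beta-2}) \] and \[ \Gamma^{2^{\beta-1}, 2^{\beta}}(-1 + 2^{\beta-2},\ -3 - 2^{\beta-2},\ 1 - 2^{\beta-2},\ 3 - 2^{\beta-2}) \] are the automorphism groups of tight chiral polyhedra of type $\{2^{\beta-1}, 2^{\beta}\}$.
   Context: For integers $p,q,i_1,j_1,i_2,j_2$, $\Gamma^{p,q}(i_1,j_1,i_2,j_2)$ denotes the group with presentation $\langle \sigma_1,\sigma_2 \mid \sigma_1^p=\sigma_2^q=(\sigma_1\sigma_2)^2=1,\ \sigma_2^{-1}\sigma_1=\sigma_1^{i_1}\sigma_2^{j_1},\ \sigma_2\sigma_1^{-1}=\sigma_1^{i_2}\sigma_2^{j_2}\rangle$. An (abstract) polyhedron is a partially ordered set whose elements have rank $0$, $1$, $2$ (vertices, edges, faces), incidence meaning comparability, such that every edge is incident to exactly two vertices and two faces, whenever a vertex is incident to a face exactly two edges are incident to both, the incidence graph is connected, and for each vertex or face the subgraph of the incidence graph induced on its neighbours is connected. A flag is a mutually incident (vertex, edge, face) triple; $\Phi^i$ is the flag differing from $\Phi$ exactly in its rank-$i$ element. Type $\{p,q\}$: faces are incident to $p$ edges and vertices to $q$ edges. The polyhedron is chiral if its flags split into two classes with $\Phi,\Phi^i$ always in different classes and the automorphism group transitive on each class but not on all flags; then, fixing a base flag $\Phi$, the automorphism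 group is generated by $\sigma_1:\Phi\mapsto(\Phi^1)^0$ and $\sigma_2:\Phi\mapsto(\Phi^2)^1$. A group $\langle\sigma_1,\sigma_2\rangle$ "is the automorphism group of" such a polyhedron if there is an isomorphism onto it sending the generators $\sigma_1,\sigma_2$ to these distinguished generators. A polyhedron of type $\{p,q\}$ is tight if it has exactly $2pq$ flags. *)

theory Defs
  imports "HOL-Algebra.Bij"
begin

section \<open>Groups given by generators and relations\<close>

text \<open>The letter \<open>(g, True)\<close> stands for the generator \<open>g\<close>, and \<open>(g, False)\<close> for its inverse.
  The pair \<open>(u, v)\<close> in a set of relations stands for \<open>u = v\<close>.\<close>

type_synonym 'g gword = "('g \<times> bool) list"

inductive pres_eq :: "('g gword \<times> 'g gword) set \<Rightarrow> 'g gword \<Rightarrow> 'g gword \<Rightarrow> bool"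
  for R :: "('g gword \<times> 'g gword) set"
where
  refl: "pres_eq R u u"
| sym: "pres_eq R u v \<Longrightarrow> pres_eq R v u"
| trans: "pres_eq R u v \<Longrightarrow> pres_eq R v w \<Longrightarrow> pres_eq R u w"
| cong: "pres_eq R u v \<Longrightarrow> pres_eq R (x @ u @ y) (x @ v @ y)"
| cancel: "pres_eq R [(g, b), (g, \<not> b)] []"
| relation: "(u, v) \<in> R \<Longrightarrow> pres_eq R u v"

definition pres_class :: "('g gword \<times> 'g gword) set \<Rightarrow> 'g gword \<Rightarrow> 'g gword set" where
  "pres_class R u = {v. pres_eq R u v}"

definition presented_group :: "('g gword \<times> 'g gword) set \<Rightarrow> 'g gword set monoid" where
  "presented_group R =
    \<lparr>carrier = range (pres_class R),
     mult = (\<lambda>A B. {w. \<exists>u\<in>A. \<exists>v\<in>B. pres_eq R (u @ v) w}),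
     one = pres_class R []\<rparr>"

lemma pres_class_eq_iff: "pres_class R u = pres_class R v \<longleftrightarrow> pres_eq R u v"
  unfolding pres_class_def by (auto intro: pres_eq.refl pres_eq.sym pres_eq.trans)

lemma pres_eq_append:
  assumes "pres_eq R u u'" and "pres_eq R v v'"
  shows "pres_eq R (u @ v) (u' @ v')"
  using pres_eq.cong[OF assms(1), of "[]" v] pres_eq.cong[OF assms(2), of u' "[]"]
  by (auto intro: pres_eq.trans)

lemma mult_pres_class:
  "pres_class R u \<otimes>\<^bsub>presented_group R\<^esub> pres_class R v = pres_class R (u @ v)"
  unfolding presented_group_def pres_class_def
  by (auto intro: pres_eq.refl pres_eq.trans pres_eq_append)

lemma pres_eq_inverse_left: "pres_eq R (rev (map (\<lambda>(g, b). (g, \<not> b)) u) @ u) []"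
proof (induction u)
  case Nil
  show ?case by (simp add: pres_eq.refl)
next
  case (Cons a u)
  obtain g b where a: "a = (g, b)" by (cases a)
  have "pres_eq R (rev (map (\<lambda>(g, b). (g, \<not> b)) u) @ [(g, \<not> b), (g, b)] @ u)
      (rev (map (\<lambda>(g, b). (g, \<not> b)) u) @ [] @ u)"
    using pres_eq.cong[OF pres_eq.cancel[of R g "\<not> b"]] by simp
  with Cons.IH show ?case by (auto simp: a intro: pres_eq.trans)
qed

lemma carrier_presented_group: "carrier (presented_group R) = range (pres_class R)"
  and one_presented_group: "\<one>\<^bsub>presented_group R\<^esub> = pres_class R []"
  by (simp_all add: presented_group_def)

lemma group_presented_group: "group (presented_group R)"
proof (rule groupI)
  show "\<exists>y\<in>carrier (presented_group R). y \<otimes>\<^bsub>presented_group R\<^esub> x = \<one>\<^bsub>presented_group R\<^esub>"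
    if x_in: "x \<in> carrier (presented_group R)" for x
  proof -
    obtain u where x: "x = pres_class R u" using x_in by (auto simp: carrier_presented_group)
    have "pres_class R (rev (map (\<lambda>(g, b). (g, \<not> b)) u)) \<otimes>\<^bsub>presented_group R\<^esub> x
        = \<one>\<^bsub>presented_group R\<^esub>"
      using pres_eq_inverse_left[of R u]
      by (simp add: x one_presented_group mult_pres_class pres_class_eq_iff)
    then show ?thesis by (auto simp: carrier_presented_group)
  qed
qed (auto simp: carrier_presented_group one_presented_group mult_pres_class)


section \<open>The groups $\Gamma^{p,q}(i_1,j_1,i_2,j_2)$\<close>

datatype gen = Sig1 | Sig2

definition gpow :: "'g \<Rightarrow> int \<Rightarrow> 'g gword" where
  "gpow g k = replicate (nat \<bar>k\<bar>) (g, 0 \<le> k)"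

definition Gamma_relations ::
    "int \<Rightarrow> int \<Rightarrow> int \<Rightarrow> int \<Rightarrow> int \<Rightarrow> int \<Rightarrow> (gen gword \<times> gen gword) set" where
  "Gamma_relations p q i\<^sub>1 j\<^sub>1 i\<^sub>2 j\<^sub>2 =
    {(gpow Sig1 p, []),
     (gpow Sig2 q, []),
     (gpow Sig1 1 @ gpow Sig2 1 @ gpow Sig1 1 @ gpow Sig2 1, []),
     (gpow Sig2 (- 1) @ gpow Sig1 1, gpow Sig1 i\<^sub>1 @ gpow Sig2 j\<^sub>1),
     (gpow Sig2 1 @ gpow Sig1 (- 1), gpow Sig1 i\<^sub>2 @ gpow Sig2 j\<^sub>2)}"

definition Gamma ::
    "int \<Rightarrow> int \<Rightarrow> int \<Rightarrow> int \<Rightarrow> int \<Rightarrow> int \<Rightarrow> gen gword set monoid" where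
  "Gamma p q i\<^sub>1 j\<^sub>1 i\<^sub>2 j\<^sub>2 = presented_group (Gamma_relations p q i\<^sub>1 j\<^sub>1 i\<^sub>2 j\<^sub>2)"

definition Gamma_gen ::
    "int \<Rightarrow> int \<Rightarrow> int \<Rightarrow> int \<Rightarrow> int \<Rightarrow> int \<Rightarrow> gen \<Rightarrow> gen gword set" where
  "Gamma_gen p q i\<^sub>1 j\<^sub>1 i\<^sub>2 j\<^sub>2 s = pres_class (Gamma_relations p q i\<^sub>1 j\<^sub>1 i\<^sub>2 j\<^sub>2) [(s, True)]"


section \<open>Abstract polyhedra\<close>

record 'a ranked_poset =
  elems :: "'a set"
  ord :: "'a rel"
  rk :: "'a \<Rightarrow> nat"

definition of_rank :: "'a ranked_poset \<Rightarrow> nat \<Rightarrow> 'a set" where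
  "of_rank P i = {x \<in> elems P. rk P x = i}"

definition incident :: "'a ranked_poset \<Rightarrow> 'a \<Rightarrow> 'a \<Rightarrow> bool" where
  "incident P x y \<longleftrightarrow> x \<in> elems P \<and> y \<in> elems P \<and> ((x, y) \<in> ord P \<or> (y, x) \<in> ord P)"

definition neighbours :: "'a ranked_poset \<Rightarrow> 'a \<Rightarrow> 'a set" where
  "neighbours P x = {y. incident P x y \<and> y \<noteq> x}"

definition induced_connected :: "'a ranked_poset \<Rightarrow> 'a set \<Rightarrow> bool" where
  "induced_connected P S \<longleftrightarrow>
    (\<forall>x\<in>S. \<forall>y\<in>S. (x, y) \<in> {(u, v). u \<in> S \<and> v \<in> S \<and> v \<in> neighbours P u}\<^sup>*)"

definition polyhedron :: "'a ranked_poset \<Rightarrow> bool" where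
  "polyhedron P \<longleftrightarrow>
    partial_order_on (elems P) (ord P) \<and>
    (\<forall>x\<in>elems P. rk P x \<in> {0, 1, 2}) \<and>
    (\<forall>x y. (x, y) \<in> ord P \<and> x \<noteq> y \<longrightarrow> rk P x < rk P y) \<and>
    (\<forall>e\<in>of_rank P 1. card {v \<in> of_rank P 0. incident P v e} = 2 \<and>
                     card {f \<in> of_rank P 2. incident P e f} = 2) \<and>
    (\<forall>v\<in>of_rank P 0. \<forall>f\<in>of_rank P 2. incident P v f \<longrightarrow>
        card {e \<in> of_rank P 1. incident P v e \<and> incident P e f} = 2) \<and>
    induced_connected P (elems P) \<and>
    (\<forall>x\<in>of_rank P 0 \<union> of_rank P 2. induced_connected P (neighbours P x))"

definition has_type :: "'a ranked_poset \<Rightarrow> nat \<Rightarrow> nat \<Rightarrow> bool" where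
  "has_type P p q \<longleftrightarrow>
    (\<forall>f\<in>of_rank P 2. card {e \<in> of_rank P 1. incident P e f} = p) \<and>
    (\<forall>v\<in>of_rank P 0. card {e \<in> of_rank P 1. incident P v e} = q)"

type_synonym 'a flag = "'a \<times> 'a \<times> 'a"

definition flags :: "'a ranked_poset \<Rightarrow> 'a flag set" where
  "flags P = {(v, e, f). v \<in> of_rank P 0 \<and> e \<in> of_rank P 1 \<and> f \<in> of_rank P 2 \<and>
                incident P v e \<and> incident P e f \<and> incident P v f}"

fun flag_nth :: "'a flag \<Rightarrow> nat \<Rightarrow> 'a" where
  "flag_nth (v, e, f) i = (if i = 0 then v else if i = 1 then e else f)"

text \<open>\<open>adj P i \<Phi>\<close> is the flag $\Phi^i$; it exists and is unique when \<open>P\<close> is a polyhedron.\<close>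

definition adj :: "'a ranked_poset \<Rightarrow> nat \<Rightarrow> 'a flag \<Rightarrow> 'a flag" where
  "adj P i \<Phi> =
    (THE \<Psi>. \<Psi> \<in> flags P \<and> (\<forall>j\<in>{0, 1, 2}. flag_nth \<Psi> j \<noteq> flag_nth \<Phi> j \<longleftrightarrow> j = i))"

text \<open>For polyhedra of type $\{p, q\}$.\<close>

definition tight :: "'a ranked_poset \<Rightarrow> nat \<Rightarrow> nat \<Rightarrow> bool" where
  "tight P p q \<longleftrightarrow> finite (flags P) \<and> card (flags P) = 2 * p * q"


section \<open>Automorphisms and chirality\<close>

definition poset_auts :: "'a ranked_poset \<Rightarrow> ('a \<Rightarrow> 'a) set" where
  "poset_auts P = {\<alpha> \<in> Bij (elems P).
    \<forall>x\<in>elems P. \<forall>y\<in>elems P. (\<alpha> x, \<alpha> y) \<in> ord P \<longleftrightarrow> (x, y) \<in> ord P}"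

definition aut_group :: "'a ranked_poset \<Rightarrow> ('a \<Rightarrow> 'a) monoid" where
  "aut_group P = BijGroup (elems P) \<lparr>carrier := poset_auts P\<rparr>"

definition flag_map :: "('a \<Rightarrow> 'a) \<Rightarrow> 'a flag \<Rightarrow> 'a flag" where
  "flag_map \<alpha> = map_prod \<alpha> (map_prod \<alpha> \<alpha>)"

definition flag_transitive_on :: "'a ranked_poset \<Rightarrow> 'a flag set \<Rightarrow> bool" where
  "flag_transitive_on P C \<longleftrightarrow> (\<forall>\<Phi>\<in>C. \<forall>\<Psi>\<in>C. \<exists>\<alpha>\<in>poset_auts P. flag_map \<alpha> \<Phi> = \<Psi>)"

definition chiral :: "'a ranked_poset \<Rightarrow> bool" where
  "chiral P \<longleftrightarrow>
    (\<exists>A B. A \<union> B = flags P \<and> A \<inter> B = {} \<and>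
       (\<forall>\<Phi>\<in>flags P. \<forall>i\<in>{0, 1, 2}. adj P i \<Phi> \<in> A \<longleftrightarrow> \<Phi> \<in> B) \<and>
       flag_transitive_on P A \<and> flag_transitive_on P B) \<and>
    \<not> flag_transitive_on P (flags P)"

text \<open>Automorphisms compose as functions, so they act from the left.  With the base flag
  existentially quantified, letting them act from the right would give the same notion: passing
  from the base flag $\Phi$ to $\Phi^1$ replaces both distinguished generators by their inverses,
  and inversion is an isomorphism onto the opposite group.\<close>

definition is_aut_group_of ::
    "('g, 'm) monoid_scheme \<Rightarrow> 'g \<Rightarrow> 'g \<Rightarrow> 'a ranked_poset \<Rightarrow> bool" where
  "is_aut_group_of G s\<^sub>1 s\<^sub>2 P \<longleftrightarrow>
    (\<exists>\<Phi>\<in>flags P. \<exists>h\<in>iso G (aut_group P).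
       flag_map (h s\<^sub>1) \<Phi> = adj P 0 (adj P 1 \<Phi>) \<and>
       flag_map (h s\<^sub>2) \<Phi> = adj P 1 (adj P 2 \<Phi>))"

text \<open>Tight polyhedra are finite, so taking the elements to be natural numbers
  is no restriction.\<close>

definition Gamma_is_aut_group_of_tight_chiral ::
    "nat \<Rightarrow> nat \<Rightarrow> int \<Rightarrow> int \<Rightarrow> int \<Rightarrow> int \<Rightarrow> bool" where
  "Gamma_is_aut_group_of_tight_chiral p q i\<^sub>1 j\<^sub>1 i\<^sub>2 j\<^sub>2 \<longleftrightarrow>
    (\<exists>P :: nat ranked_poset.
       polyhedron P \<and> has_type P p q \<and> tight P p q \<and> chiral P \<and>
       is_aut_group_of (Gamma (int p) (int q) i\<^sub>1 j\<^sub>1 i\<^sub>2 j\<^sub>2)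
         (Gamma_gen (int p) (int q) i\<^sub>1 j\<^sub>1 i\<^sub>2 j\<^sub>2 Sig1)
         (Gamma_gen (int p) (int q) i\<^sub>1 j\<^sub>1 i\<^sub>2 j\<^sub>2 Sig2) P)"

end

theory Submission
  imports Defs
begin

text \<open>Write $x = \sigma_1$, $y = \sigma_2$, $2^{\beta - 2} = 8t$ and $T = \pm t$, so that the exponents in the
  presentation are $8t - 1$, $8T - 3$, $1 - 8t$ and $8T + 3$; the argument works for every $t \geq 1$.

  The relations say that $x$ almost commutes with $y^2$, up to the involution $z = x^{8t}$ and a
  power of $y$.  They force $z$ to commute with $y^2$, then $x y^4 x^{-1} = y^{4 - 16T}$, and finally
  $y x^k \in \langle x \rangle \langle y \rangle$ for all $k$, so that
  $\Gamma = \langle x \rangle \langle y \rangle$.  Conversely, explicit actions of $\Gamma$ on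
  the integers modulo $16t$ and modulo $32t$ show that $x^i y^j = 1$ only if $16t \mid i$ and
  $32t \mid j$.

  For any group that is such an exact product, the coset geometry of $\langle y \rangle$,
  $\langle yx \rangle$ and $\langle x \rangle$ is a tight polyhedron in which every vertex lies on
  every face, and it is chiral with automorphism group $\Gamma$ unless some endomorphism inverts
  both generators.  Such an endomorphism would turn the first of the two special relations into
  $y x^{-1} = x^{1 - 8t} y^{3 - 8T}$, which contradicts the second one as $y^{16T} \neq 1$.\<close>


section \<open>Flags and automorphisms of polyhedra\<close>

text \<open>A presentation bounds a group only from above, so tightness needs two halves: the
  relations bring every word into the form x^i y^j, and concrete models show that nothing collapses
  further. A single faithful model would require the whole multiplication table of the group. The
  two coset actions need only formulas for one coordinate each, and they separate the exponents in
  turn: the base vertex is fixed by y and detects i, and once x^i is trivial the base face detects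
  j. On the side of the relations, everything comes from knowing the conjugates of y^2 by x in both
  directions: x^-1 y^2 x = z y^(8T+2) and x y^2 x^-1 = y^(2-8T) z. Comparing the two is what forces
  z to commute. On the geometric side, exactness means that a coset of <y> and a coset of <x> meet
  in exactly one element, so group elements are vertex-face pairs, each carrying two flags. Left
  multiplication gives automorphisms, right multiplication gives steps between flags. In the second
  class of flags the same steps multiply by the inverse generators, which explains the criterion for
  chirality.\<close>

definition is_adj :: "'a ranked_poset \<Rightarrow> nat \<Rightarrow> 'a flag \<Rightarrow> 'a flag \<Rightarrow> bool" where
  "is_adj P i \<Phi> \<Psi> \<longleftrightarrow> \<Phi> \<in> flags P \<and> \<Psi> \<in> flags P \<and>
    (\<forall>j\<in>{0, 1, 2}. flag_nth \<Psi> j \<noteq> flag_nth \<Phi> j \<longleftrightarrow> j = i)"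

lemma is_adj_sym: "is_adj P i \<Phi> \<Psi> \<Longrightarrow> is_adj P i \<Psi> \<Phi>"
  unfolding is_adj_def by metis

lemma card_2_unique_other: "card S = 2 \<Longrightarrow> {a, b, c} \<subseteq> S \<Longrightarrow> b \<noteq> a \<Longrightarrow> c \<noteq> a \<Longrightarrow> b = c"
  by (auto simp: card_2_iff)

text \<open>In each rank the original element and any two candidates for its replacement lie in a
  set that the polyhedron axioms give size 2. Exhibiting a flag related by \<open>is_adj\<close>
  therefore evaluates the definite description \<open>adj\<close>.\<close>

lemma adj_eqI:
  assumes P: "polyhedron P" and adj: "is_adj P i \<Phi> \<Psi>" and i: "i \<in> {0, 1, 2}"
  shows "adj P i \<Phi> = \<Psi>"
  unfolding adj_def
proof (rule the_equality)
  show "\<Psi> \<in> flags P \<and> (\<forall>j\<in>{0, 1, 2}. (flag_nth \<Psi> j \<noteq> flag_nth \<Phi> j) = (j = i))"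
    using adj by (simp add: is_adj_def)
next
  fix \<Omega>
  assume \<Omega>: "\<Omega> \<in> flags P \<and> (\<forall>j\<in>{0, 1, 2}. (flag_nth \<Omega> j \<noteq> flag_nth \<Phi> j) = (j = i))"
  obtain v e f where \<Phi>: "\<Phi> = (v, e, f)" by (cases \<Phi>)
  obtain v' e' f' where \<Psi>: "\<Psi> = (v', e', f')" by (cases \<Psi>)
  obtain v'' e'' f'' where \<Omega>': "\<Omega> = (v'', e'', f'')" by (cases \<Omega>)
  have fl: "(v, e, f) \<in> flags P" "(v', e', f') \<in> flags P" "(v'', e'', f'') \<in> flags P"
    using adj \<Omega> by (auto simp: is_adj_def \<Phi> \<Psi> \<Omega>')
  have d: "\<forall>j\<in>{0, 1, 2}. (flag_nth (v', e', f') j \<noteq> flag_nth (v, e, f) j) = (j = i)"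
    "\<forall>j\<in>{0, 1, 2}. (flag_nth (v'', e'', f'') j \<noteq> flag_nth (v, e, f) j) = (j = i)"
    using adj \<Omega> by (auto simp only: is_adj_def \<Phi> \<Psi> \<Omega>')
  consider "i = 0" | "i = 1" | "i = 2" using i by auto
  then show "\<Omega> = \<Psi>"
  proof cases
    case 1
    then have eq: "e' = e" "e'' = e" "f' = f" "f'' = f" "v' \<noteq> v" "v'' \<noteq> v"
      using d by auto
    have "card {v \<in> of_rank P 0. incident P v e} = 2"
      using P fl(1) by (auto simp: polyhedron_def flags_def)
    from card_2_unique_other[OF this, of v v'' v'] fl eq show ?thesis
      by (auto simp: \<Psi> \<Omega>' flags_def)
  next
    case 2
    then have eq: "v' = v" "v'' = v" "f' = f" "f'' = f" "e' \<noteq> e" "e'' \<noteq> e"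
      using d by auto
    have "card {e \<in> of_rank P 1. incident P v e \<and> incident P e f} = 2"
      using P fl(1) by (auto simp: polyhedron_def flags_def)
    from card_2_unique_other[OF this, of e e'' e'] fl eq show ?thesis
      by (auto simp: \<Psi> \<Omega>' flags_def)
  next
    case 3
    then have eq: "v' = v" "v'' = v" "e' = e" "e'' = e" "f' \<noteq> f" "f'' \<noteq> f"
      using d by auto
    have "card {f \<in> of_rank P 2. incident P e f} = 2"
      using P fl(1) by (auto simp: polyhedron_def flags_def)
    from card_2_unique_other[OF this, of f f'' f'] fl eq show ?thesis
      by (auto simp: \<Psi> \<Omega>' flags_def)
  qed
qed

lemma flag_ordD:
  assumes "polyhedron P" and "(v, e, f) \<in> flags P"
  shows "(v, e) \<in> ord P" "(e, f) \<in> ord P"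
proof -
  have rk: "(a, b) \<in> ord P \<Longrightarrow> a \<noteq> b \<Longrightarrow> rk P a < rk P b" for a b
    using assms(1) by (auto simp: polyhedron_def)
  show "(v, e) \<in> ord P" "(e, f) \<in> ord P"
    using assms(2) rk[of e v] rk[of f e] by (auto simp: flags_def of_rank_def incident_def)
qed

text \<open>\<open>poset_auts\<close> asks for preservation of the order only, not of rank. The
  image of a flag is still a chain with strictly increasing ranks, and only the ranks 0, 1, 2 are
  available.\<close>

lemma flag_map_in_flags:
  assumes P: "polyhedron P" and \<alpha>: "\<alpha> \<in> poset_auts P" and \<Phi>: "\<Phi> \<in> flags P"
  shows "flag_map \<alpha> \<Phi> \<in> flags P"
proof -
  obtain v e f where vef: "\<Phi> = (v, e, f)" by (cases \<Phi>)
  have el: "v \<in> elems P" "e \<in> elems P" "f \<in> elems P"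
    and rks: "rk P v = 0" "rk P e = 1" "rk P f = 2"
    using \<Phi> by (auto simp: vef flags_def of_rank_def)
  have rk: "(a, b) \<in> ord P \<Longrightarrow> a \<noteq> b \<Longrightarrow> rk P a < rk P b" for a b
    using P by (auto simp: polyhedron_def)
  have bij: "bij_betw \<alpha> (elems P) (elems P)"
    and ord: "\<And>a b. a \<in> elems P \<Longrightarrow> b \<in> elems P \<Longrightarrow> (\<alpha> a, \<alpha> b) \<in> ord P \<longleftrightarrow> (a, b) \<in> ord P"
    using \<alpha> by (auto simp: poset_auts_def Bij_def)
  have el': "\<alpha> v \<in> elems P" "\<alpha> e \<in> elems P" "\<alpha> f \<in> elems P"
    using bij el by (auto simp: bij_betw_def)
  have o: "(\<alpha> v, \<alpha> e) \<in> ord P" "(\<alpha> e, \<alpha> f) \<in> ord P"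
    using flag_ordD[OF P, of v e f] \<Phi> ord el by (auto simp: vef)
  have "\<alpha> v \<noteq> \<alpha> e" "\<alpha> e \<noteq> \<alpha> f"
    using bij el rks by (auto simp: bij_betw_def dest: inj_onD)
  then have "rk P (\<alpha> v) < rk P (\<alpha> e)" "rk P (\<alpha> e) < rk P (\<alpha> f)"
    using rk o by auto
  moreover have "rk P (\<alpha> f) \<le> 2"
    using P el' by (auto simp: polyhedron_def)
  ultimately have "rk P (\<alpha> v) = 0" "rk P (\<alpha> e) = 1" "rk P (\<alpha> f) = 2"
    by linarith+
  moreover have "incident P (\<alpha> v) (\<alpha> f)"
    using \<Phi> el el' ord by (auto simp: vef flags_def incident_def)
  ultimately show ?thesis
    using el' o by (auto simp: vef flag_map_def flags_def of_rank_def incident_def)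
qed

lemma is_adj_flag_map:
  assumes P: "polyhedron P" and \<alpha>: "\<alpha> \<in> poset_auts P" and adj: "is_adj P i \<Phi> \<Psi>"
  shows "is_adj P i (flag_map \<alpha> \<Phi>) (flag_map \<alpha> \<Psi>)"
proof -
  obtain v e f where \<Phi>: "\<Phi> = (v, e, f)" by (cases \<Phi>)
  obtain v' e' f' where \<Psi>: "\<Psi> = (v', e', f')" by (cases \<Psi>)
  have "inj_on \<alpha> (elems P)"
    using \<alpha> by (auto simp: poset_auts_def Bij_def bij_betw_def)
  moreover have "{v, e, f, v', e', f'} \<subseteq> elems P"
    using adj by (auto simp: \<Phi> \<Psi> is_adj_def flags_def of_rank_def)
  ultimately have inj: "\<alpha> v' = \<alpha> v \<longleftrightarrow> v' = v" "\<alpha> e' = \<alpha> e \<longleftrightarrow> e' = e" "\<alpha> f' = \<alpha> f \<longleftrightarrow> f' = f"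
    by (auto dest: inj_onD)
  have "flag_map \<alpha> \<Phi> \<in> flags P" "flag_map \<alpha> \<Psi> \<in> flags P"
    using adj flag_map_in_flags[OF P \<alpha>] by (auto simp: is_adj_def)
  then show ?thesis
    using adj by (auto simp: \<Phi> \<Psi> is_adj_def flag_map_def inj)
qed

lemma adj_flag_map:
  assumes P: "polyhedron P" and \<alpha>: "\<alpha> \<in> poset_auts P" and adj: "is_adj P i \<Phi> \<Psi>"
    and i: "i \<in> {0, 1, 2}"
  shows "flag_map \<alpha> \<Psi> = adj P i (flag_map \<alpha> \<Phi>)"
  using adj_eqI[OF P is_adj_flag_map[OF P \<alpha> adj] i] by simp

lemma induced_connectedI:
  assumes "\<And>u. u \<in> S \<Longrightarrow> (u, c) \<in> {(u, v). u \<in> S \<and> v \<in> S \<and> v \<in> neighbours P u}\<^sup>*"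
  shows "induced_connected P S"
proof -
  let ?r = "{(u, v). u \<in> S \<and> v \<in> S \<and> v \<in> neighbours P u}"
  have "sym ?r"
    by (auto simp: sym_def neighbours_def incident_def)
  then have "sym (?r\<^sup>*)"
    by (rule sym_rtrancl)
  then have "(u, w) \<in> ?r\<^sup>*" if "u \<in> S" "w \<in> S" for u w
    using assms[OF that(1)] assms[OF that(2)] by (meson rtrancl_trans symD)
  then show ?thesis
    by (simp add: induced_connected_def)
qed


section \<open>The coset geometry of an exact product of cyclic groups\<close>

context group
begin

lemma pow_mod:
  assumes [simp]: "a \<in> carrier G" and a: "a [^] (n::nat) = \<one>"
  shows "a [^] (i mod n) = a [^] (i::nat)"
proof -
  have "a [^] i = a [^] (n * (i div n) + i mod n)"
    by simp
  also have "\<dots> = a [^] (i mod n)"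
    using nat_pow_pow[of a n "i div n"] a by (simp only: nat_pow_mult[symmetric] assms) simp
  finally show ?thesis ..
qed

lemma pow_coset_eq_iff:
  fixes n :: nat
  assumes [simp]: "a \<in> carrier G" "g \<in> carrier G" "h \<in> carrier G"
    and a: "a [^] n = \<one>" "n > 0"
  shows "range (\<lambda>i::nat. g \<otimes> a [^] i) = range (\<lambda>i::nat. h \<otimes> a [^] i) \<longleftrightarrow> (\<exists>i::nat. h = g \<otimes> a [^] i)"
proof
  have "h \<in> range (\<lambda>i::nat. h \<otimes> a [^] i)"
    by (rule range_eqI[of _ _ 0]) simp
  then show "\<exists>i::nat. h = g \<otimes> a [^] i"
    if "range (\<lambda>i::nat. g \<otimes> a [^] i) = range (\<lambda>i::nat. h \<otimes> a [^] i)"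
    using that by blast
next
  assume "\<exists>i::nat. h = g \<otimes> a [^] i"
  then obtain i :: nat where h: "h = g \<otimes> a [^] i" ..
  \<comment> \<open>Cosets are written with natural exponents, so a^((n-1)i) stands in for the
    inverse of a^i.\<close>
  have "i + (n - 1) * i = n * i"
    using a(2) by (cases n) simp_all
  then have "a [^] (i + (n - 1) * i) = \<one>"
    using nat_pow_pow[of a n i] a(1) by simp
  then have g: "g = h \<otimes> a [^] ((n - 1) * i)"
    by (simp add: h m_assoc nat_pow_mult)
  have sub: "range (\<lambda>i::nat. u \<otimes> a [^] i) \<subseteq> range (\<lambda>i::nat. w \<otimes> a [^] i)"
    if [simp]: "w \<in> carrier G" and u: "u = w \<otimes> a [^] j" for u w and j :: nat
    by (auto simp: u m_assoc nat_pow_mult)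
  show "range (\<lambda>i::nat. g \<otimes> a [^] i) = range (\<lambda>i::nat. h \<otimes> a [^] i)"
    using sub[OF assms(3) g] sub[OF assms(2) h] by (rule subset_antisym)
qed

end

text \<open>All that the geometry needs to know of the group: an exact product of cyclic groups of
  orders p and q whose generators satisfy (xy)^2 = 1, here in the form \<open>yx\<close>. Finite
  orders make natural exponents sufficient.\<close>

locale tight_generators = group G for G (structure) +
  fixes x y :: 'a and p q :: nat
  assumes x_closed [simp]: "x \<in> carrier G"
    and y_closed [simp]: "y \<in> carrier G"
    and p_gt_1: "p > 1" and q_gt_1: "q > 1"
    and x_pow_eq_one_iff: "x [^] (i::nat) = \<one> \<longleftrightarrow> p dvd i"
    and y_pow_eq_one_iff: "y [^] (i::nat) = \<one> \<longleftrightarrow> q dvd i"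
    and yx: "y \<otimes> x = inv x \<otimes> inv y"
    and powers_inter: "x [^] (i::nat) = y [^] (j::nat) \<Longrightarrow> x [^] i = \<one>"
    and product_of_powers: "g \<in> carrier G \<Longrightarrow> \<exists>i j. g = x [^] (i::nat) \<otimes> y [^] (j::nat)"
begin

lemma x_pow_inj: "i < p \<Longrightarrow> k < p \<Longrightarrow> x [^] i = x [^] k \<Longrightarrow> i = k" for i k :: nat
proof (induction i k rule: linorder_wlog)
  case (le i k)
  have "x [^] i \<otimes> x [^] (k - i) = x [^] k"
    using le(1) by (simp add: nat_pow_mult)
  then have "x [^] i \<otimes> x [^] (k - i) = x [^] i \<otimes> \<one>"
    using le by simp
  then have "p dvd k - i"
    by (simp add: x_pow_eq_one_iff[symmetric])
  then show ?case
    using le by (auto dest: dvd_imp_le)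
qed simp

lemma y_pow_inj: "i < q \<Longrightarrow> k < q \<Longrightarrow> y [^] i = y [^] k \<Longrightarrow> i = k" for i k :: nat
proof (induction i k rule: linorder_wlog)
  case (le i k)
  have "y [^] i \<otimes> y [^] (k - i) = y [^] k"
    using le(1) by (simp add: nat_pow_mult)
  then have "y [^] i \<otimes> y [^] (k - i) = y [^] i \<otimes> \<one>"
    using le by simp
  then have "q dvd k - i"
    by (simp add: y_pow_eq_one_iff[symmetric])
  then show ?case
    using le by (auto dest: dvd_imp_le)
qed simp

lemma x_ne_one: "x \<noteq> \<one>" and y_ne_one: "y \<noteq> \<one>"
  using x_pow_eq_one_iff[of 1] y_pow_eq_one_iff[of 1] p_gt_1 q_gt_1 by auto

lemma carrier_eq: "carrier G = (\<lambda>(i, j). x [^] (i::nat) \<otimes> y [^] (j::nat)) ` ({..<p} \<times> {..<q})"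
proof -
  have "g \<in> (\<lambda>(i, j). x [^] (i::nat) \<otimes> y [^] (j::nat)) ` ({..<p} \<times> {..<q})" if "g \<in> carrier G" for g
  proof -
    obtain i j :: nat where "g = x [^] i \<otimes> y [^] j"
      using product_of_powers \<open>g \<in> carrier G\<close> by blast
    then have "g = x [^] (i mod p) \<otimes> y [^] (j mod q)"
      by (simp add: pow_mod x_pow_eq_one_iff y_pow_eq_one_iff)
    moreover have "i mod p < p" "j mod q < q"
      using p_gt_1 q_gt_1 by auto
    ultimately show ?thesis by force
  qed
  then show ?thesis by auto
qed

lemma finite_carrier: "finite (carrier G)"
  by (subst carrier_eq) simp

end

text \<open>\<open>V\<close>, \<open>E\<close> and \<open>F\<close> encode the left cosets of \<open>\<langle>y\<rangle>\<close>, \<open>\<langle>yx\<rangle>\<close> and \<open>\<langle>x\<rangle>\<close>.  With these choices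
  the base flag is the triple of subgroups itself and \<open>x\<close>, \<open>y\<close> act as the distinguished
  generators.\<close>

locale coset_polyhedron = tight_generators G x y p q for G (structure) and x y :: 'a and p q +
  fixes V E F :: "'a \<Rightarrow> 'b"
  assumes V_eq_iff: "g \<in> carrier G \<Longrightarrow> h \<in> carrier G \<Longrightarrow> V g = V h \<longleftrightarrow> (\<exists>i::nat. h = g \<otimes> y [^] i)"
    and F_eq_iff: "g \<in> carrier G \<Longrightarrow> h \<in> carrier G \<Longrightarrow> F g = F h \<longleftrightarrow> (\<exists>i::nat. h = g \<otimes> x [^] i)"
    and E_eq_iff: "g \<in> carrier G \<Longrightarrow> h \<in> carrier G \<Longrightarrow> E g = E h \<longleftrightarrow> h = g \<or> h = g \<otimes> (y \<otimes> x)"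
    and distinct_ranks: "V g \<noteq> E h" "V g \<noteq> F h" "E g \<noteq> F h"
begin

abbreviation "C \<equiv> carrier G"

text \<open>Relating all vertices to all faces is forced by transitivity: by \<open>V_F_surj\<close>
  some k represents both, and then \<open>E k\<close> lies between them.\<close>

definition P :: "'b ranked_poset" where
  "P = \<lparr>elems = V ` C \<union> E ` C \<union> F ` C,
    ord = Id_on (V ` C \<union> E ` C \<union> F ` C) \<union> {(V g, E g) | g. g \<in> C} \<union> {(E g, F g) | g. g \<in> C}
      \<union> V ` C \<times> F ` C,
    rk = (\<lambda>u. if u \<in> V ` C then 0 else if u \<in> E ` C then 1 else 2)\<rparr>"

lemmas distinct_ranks' [simp] = distinct_ranks distinct_ranks[symmetric]

lemma V_mult_y [simp]: "g \<in> C \<Longrightarrow> V (g \<otimes> y) = V g"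
  using V_eq_iff[of g "g \<otimes> y"] by (auto intro: exI[of _ "1 :: nat"])

lemma F_mult_x [simp]: "g \<in> C \<Longrightarrow> F (g \<otimes> x) = F g"
  using F_eq_iff[of g "g \<otimes> x"] by (auto intro: exI[of _ "1 :: nat"])

lemma V_mult_inv_y [simp]: "g \<in> C \<Longrightarrow> V (g \<otimes> inv y) = V g"
  using V_mult_y[of "g \<otimes> inv y"] by (simp add: m_assoc)

lemma F_mult_inv_x [simp]: "g \<in> C \<Longrightarrow> F (g \<otimes> inv x) = F g"
  using F_mult_x[of "g \<otimes> inv x"] by (simp add: m_assoc)

lemma V_mult_y_pow [simp]: "g \<in> C \<Longrightarrow> V (g \<otimes> y [^] (i::nat)) = V g"
  using V_eq_iff[of g "g \<otimes> y [^] i"] by auto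

lemma F_mult_x_pow [simp]: "g \<in> C \<Longrightarrow> F (g \<otimes> x [^] (i::nat)) = F g"
  using F_eq_iff[of g "g \<otimes> x [^] i"] by auto

lemma V_mult_yx [simp]: "g \<in> C \<Longrightarrow> V (g \<otimes> (y \<otimes> x)) = V (g \<otimes> inv x)"
  by (simp add: yx m_assoc[symmetric])

lemma F_mult_yx [simp]: "g \<in> C \<Longrightarrow> F (g \<otimes> (y \<otimes> x)) = F (g \<otimes> y)"
  by (simp add: m_assoc[symmetric])

lemma E_mult_yx [simp]: "g \<in> C \<Longrightarrow> E (g \<otimes> (y \<otimes> x)) = E g"
  using E_eq_iff[of g "g \<otimes> (y \<otimes> x)"] by simp

lemma E_mult_inv_y: "g \<in> C \<Longrightarrow> E (g \<otimes> inv y) = E (g \<otimes> x)"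
  using E_mult_yx[of "g \<otimes> inv y"] by (simp add: m_assoc[symmetric]) (simp add: m_assoc)

text \<open>Two elements in the same coset of <y> and the same coset of <x> differ by an element of
  both subgroups, and these intersect trivially.\<close>

lemma V_F_inj:
  assumes [simp]: "g \<in> C" "h \<in> C" and eq: "V g = V h" "F g = F h"
  shows "g = h"
proof -
  obtain i :: nat where i: "h = g \<otimes> y [^] i"
    using eq(1) by (auto simp: V_eq_iff)
  obtain j :: nat where j: "h = g \<otimes> x [^] j"
    using eq(2) by (auto simp: F_eq_iff)
  have "g \<otimes> x [^] j = g \<otimes> y [^] i"
    using i j by metis
  then have "x [^] j = \<one>"
    by (intro powers_inter) simp
  with j show ?thesis
    by simp
qed

text \<open>Writing h^-1 g = x^i y^j, the element h x^i = g y^-j lies in both cosets. With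
  \<open>V_F_inj\<close>, vertex-face pairs become the same thing as group elements.\<close>

lemma V_F_surj:
  assumes [simp]: "g \<in> C" "h \<in> C"
  shows "\<exists>k\<in>C. V k = V g \<and> F k = F h"
proof -
  obtain i j :: nat where ij: "inv h \<otimes> g = x [^] i \<otimes> y [^] j"
    using product_of_powers[of "inv h \<otimes> g"] by auto
  then have "g = h \<otimes> x [^] i \<otimes> y [^] j"
    by (metis assms inv_solve_left' m_assoc m_closed nat_pow_closed x_closed y_closed inv_closed)
  then have "V g = V (h \<otimes> x [^] i)"
    by simp
  then show ?thesis
    by (intro bexI[of _ "h \<otimes> x [^] i"]) simp_all
qed

lemma V_mult_inv_x_ne: "g \<in> C \<Longrightarrow> V (g \<otimes> inv x) \<noteq> V g"
proof
  assume g: "g \<in> C" and "V (g \<otimes> inv x) = V g"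
  then have "g \<otimes> inv x = g"
    by (intro V_F_inj) simp_all
  with g show False
    using x_ne_one by simp
qed

lemma F_mult_y_ne: "g \<in> C \<Longrightarrow> F (g \<otimes> y) \<noteq> F g"
proof
  assume g: "g \<in> C" and "F (g \<otimes> y) = F g"
  then have "g \<otimes> y = g"
    by (intro V_F_inj) simp_all
  with g show False
    using y_ne_one by simp
qed

lemma E_V_inj: "\<lbrakk>g \<in> C; h \<in> C; E g = E h; V g = V h\<rbrakk> \<Longrightarrow> g = h"
  using V_mult_inv_x_ne[of g] by (auto simp: E_eq_iff)

lemma E_F_inj: "\<lbrakk>g \<in> C; h \<in> C; E g = E h; F g = F h\<rbrakk> \<Longrightarrow> g = h"
  using F_mult_y_ne[of g] by (auto simp: E_eq_iff)

lemma E_mult_x_ne: "g \<in> C \<Longrightarrow> E (g \<otimes> x) \<noteq> E g"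
  using E_F_inj[of "g \<otimes> x" g] x_ne_one by auto

section \<open>Incidence between cosets\<close>

lemma of_rank_P: "of_rank P 0 = V ` C" "of_rank P 1 = E ` C" "of_rank P 2 = F ` C"
  "of_rank P (Suc 0) = E ` C"
  by (auto simp: of_rank_def P_def)

lemma elems_P: "elems P = V ` C \<union> E ` C \<union> F ` C"
  by (simp add: P_def)

text \<open>An edge has the two representatives h and h y x. Since y x = x^-1 y^-1, the second one
  has the vertex of h x^-1.\<close>

lemma incident_V_E:
  assumes [simp]: "g \<in> C" "h \<in> C"
  shows "incident P (V g) (E h) \<longleftrightarrow> V g = V h \<or> V g = V (h \<otimes> inv x)"
proof -
  have "incident P (V g) (E h) \<longleftrightarrow> (\<exists>k\<in>C. V g = V k \<and> E h = E k)"
    by (auto simp: incident_def P_def)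
  also have "\<dots> \<longleftrightarrow> V g = V h \<or> V g = V (h \<otimes> (y \<otimes> x))"
    by (auto simp: E_eq_iff simp del: V_mult_yx)
  finally show ?thesis by simp
qed

lemma incident_E_F:
  assumes [simp]: "g \<in> C" "h \<in> C"
  shows "incident P (E h) (F g) \<longleftrightarrow> F g = F h \<or> F g = F (h \<otimes> y)"
proof -
  have "incident P (E h) (F g) \<longleftrightarrow> (\<exists>k\<in>C. F g = F k \<and> E h = E k)"
    by (auto simp: incident_def P_def)
  also have "\<dots> \<longleftrightarrow> F g = F h \<or> F g = F (h \<otimes> (y \<otimes> x))"
    by (auto simp: E_eq_iff simp del: F_mult_yx)
  finally show ?thesis by simp
qed

lemma incident_V_F: "g \<in> C \<Longrightarrow> h \<in> C \<Longrightarrow> incident P (V g) (F h)"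
  by (auto simp: incident_def P_def)

lemma incident_sym: "incident P u w \<longleftrightarrow> incident P w u"
  by (auto simp: incident_def)

lemma edge_at_vertexE:
  assumes "g \<in> C" "h \<in> C" "incident P (V g) (E h)"
  obtains i :: nat where "i < q" "E h = E (g \<otimes> y [^] i)"
proof -
  obtain k where k: "k \<in> C" "V g = V k" "E h = E k"
    using assms incident_V_E[of g h] by (metis E_mult_yx V_mult_yx m_closed x_closed y_closed)
  then obtain i :: nat where "k = g \<otimes> y [^] i"
    using assms by (auto simp: V_eq_iff)
  then have "k = g \<otimes> y [^] (i mod q)"
    using pow_mod[of y q i] y_pow_eq_one_iff by simp
  then show ?thesis
    using that[of "i mod q"] q_gt_1 k by simp
qed

lemma edge_at_faceE:
  assumes "g \<in> C" "h \<in> C" "incident P (E h) (F g)"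
  obtains i :: nat where "i < p" "E h = E (g \<otimes> x [^] i)"
proof -
  obtain k where k: "k \<in> C" "F g = F k" "E h = E k"
    using assms incident_E_F[of g h] by (metis E_mult_yx F_mult_yx m_closed x_closed y_closed)
  then obtain i :: nat where "k = g \<otimes> x [^] i"
    using assms by (auto simp: F_eq_iff)
  then have "k = g \<otimes> x [^] (i mod p)"
    using pow_mod[of x p i] x_pow_eq_one_iff by simp
  then show ?thesis
    using that[of "i mod p"] p_gt_1 k by simp
qed

lemma edges_at_vertex:
  assumes [simp]: "g \<in> C"
  shows "{e \<in> of_rank P (Suc 0). incident P (V g) e} = (\<lambda>i::nat. E (g \<otimes> y [^] i)) ` {..<q}"
  unfolding of_rank_P by (auto simp: incident_V_E elim!: edge_at_vertexE[OF assms])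

lemma edges_at_face:
  assumes [simp]: "g \<in> C"
  shows "{e \<in> of_rank P (Suc 0). incident P e (F g)} = (\<lambda>i::nat. E (g \<otimes> x [^] i)) ` {..<p}"
  unfolding of_rank_P by (auto simp: incident_E_F elim!: edge_at_faceE[OF assms])

text \<open>An edge h offers two vertices and two faces. In each of the four combinations
  \<open>V_F_inj\<close> solves for h, giving g, g y^-1, g x or g as the second representative;
  these are only two edges, because g y^-1 (y x) = g x.\<close>

lemma edges_at_vertex_face:
  assumes [simp]: "g \<in> C"
  shows "{e \<in> of_rank P (Suc 0). incident P (V g) e \<and> incident P e (F g)} = {E g, E (g \<otimes> x)}"
proof -
  have "E h = E g \<or> E h = E (g \<otimes> x)"
    if [simp]: "h \<in> C" and inc: "incident P (V g) (E h)" "incident P (E h) (F g)" for h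
  proof -
    consider "V g = V h" "F g = F h" | "V g = V h" "F g = F (h \<otimes> y)"
      | "V g = V (h \<otimes> inv x)" "F g = F h" | "V g = V (h \<otimes> inv x)" "F g = F (h \<otimes> y)"
      using inc by (auto simp: incident_V_E incident_E_F)
    then show ?thesis
    proof cases
      case 1
      then have "g = h" by (intro V_F_inj) simp_all
      then show ?thesis by simp
    next
      case 2
      then have "g = h \<otimes> y" by (intro V_F_inj) simp_all
      then have "h = g \<otimes> inv y" by (simp add: m_assoc)
      then show ?thesis by (simp add: E_mult_inv_y)
    next
      case 3
      then have "g = h \<otimes> inv x" by (intro V_F_inj) simp_all
      then have "h = g \<otimes> x" by (simp add: m_assoc)
      then show ?thesis by simp
    next
      case 4
      then have "g = h \<otimes> (y \<otimes> x)" by (intro V_F_inj) simp_all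
      then show ?thesis by simp
    qed
  qed
  moreover have "V (g \<otimes> x \<otimes> inv x) = V g"
    by (simp add: m_assoc)
  then have "incident P (V g) (E (g \<otimes> x))" "incident P (E (g \<otimes> x)) (F g)"
      "incident P (V g) (E g)" "incident P (E g) (F g)"
    by (simp_all add: incident_V_E incident_E_F)
  ultimately show ?thesis
    unfolding of_rank_P by auto
qed

lemma partial_order_P: "partial_order_on (elems P) (ord P)"
proof -
  have "refl_on (elems P) (ord P)"
    by (auto simp: refl_on_def P_def)
  moreover have "ord P \<subseteq> elems P \<times> elems P"
    by (auto simp: P_def)
  moreover have "trans (ord P)"
    by (rule transI) (auto simp: P_def)
  moreover have "antisym (ord P)"
    by (rule antisymI) (auto simp: P_def)
  ultimately show ?thesis
    by (auto simp: partial_order_on_def preorder_on_def)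
qed

section \<open>Connectedness of the geometry and of its local sections\<close>

lemma in_neighbours [simp]:
  assumes "g \<in> C" "h \<in> C"
  shows "E h \<in> neighbours P (V g) \<longleftrightarrow> V g = V h \<or> V g = V (h \<otimes> inv x)"
    and "V g \<in> neighbours P (E h) \<longleftrightarrow> V g = V h \<or> V g = V (h \<otimes> inv x)"
    and "E h \<in> neighbours P (F g) \<longleftrightarrow> F g = F h \<or> F g = F (h \<otimes> y)"
    and "F g \<in> neighbours P (E h) \<longleftrightarrow> F g = F h \<or> F g = F (h \<otimes> y)"
    and "F h \<in> neighbours P (V g)"
    and "V h \<in> neighbours P (F g)"
  using assms by (auto simp: neighbours_def incident_V_E incident_E_F incident_V_F
      incident_sym[of "E h" "V g"] incident_sym[of "F g" "E h"] incident_sym[of "F g" "V h"])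

lemma neighbours_V: "g \<in> C \<Longrightarrow> u \<in> neighbours P (V g) \<Longrightarrow> u \<in> E ` C \<union> F ` C"
  by (auto simp: neighbours_def incident_def P_def)

lemma neighbours_F: "g \<in> C \<Longrightarrow> u \<in> neighbours P (F g) \<Longrightarrow> u \<in> E ` C \<union> V ` C"
  by (auto simp: neighbours_def incident_def P_def)

lemma connected_P: "induced_connected P (elems P)"
proof (rule induced_connectedI)
  let ?r = "{(u, v). u \<in> elems P \<and> v \<in> elems P \<and> v \<in> neighbours P u}"
  fix u assume "u \<in> elems P"
  have F: "(F g, V \<one>) \<in> ?r\<^sup>*" if "g \<in> C" for g
    using that by (intro r_into_rtrancl) (simp add: elems_P)
  have V: "(V g, V \<one>) \<in> ?r\<^sup>*" if "g \<in> C" for g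
    using that by (intro converse_rtrancl_into_rtrancl[OF _ F[of \<one>]]) (simp_all add: elems_P)
  have "(E g, V \<one>) \<in> ?r\<^sup>*" if "g \<in> C" for g
    using that by (intro converse_rtrancl_into_rtrancl[OF _ V[of g]]) (simp_all add: elems_P)
  with F V show "(u, V \<one>) \<in> ?r\<^sup>*"
    using \<open>u \<in> elems P\<close> by (auto simp: elems_P)
qed

lemma connected_vertex_figure:
  assumes [simp]: "g \<in> C"
  shows "induced_connected P (neighbours P (V g))"
proof (rule induced_connectedI)
  let ?S = "neighbours P (V g)"
  let ?r = "{(u, v). u \<in> ?S \<and> v \<in> ?S \<and> v \<in> neighbours P u}"
  fix u assume u: "u \<in> ?S"
  \<comment> \<open>Walking around the vertex: the faces of g y^(n+1) and g y^n share the edge of g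
    y^n.\<close>
  have path: "(F (g \<otimes> y [^] n), F g) \<in> ?r\<^sup>*" for n :: nat
  proof (induction n)
    case (Suc n)
    have "(E (g \<otimes> y [^] n), F g) \<in> ?r\<^sup>*"
      by (rule converse_rtrancl_into_rtrancl[OF _ Suc]) simp
    then have "(F (g \<otimes> y [^] n \<otimes> y), F g) \<in> ?r\<^sup>*"
      by (rule converse_rtrancl_into_rtrancl[rotated]) simp
    then show ?case
      by (simp add: m_assoc)
  qed simp
  have F: "(F h, F g) \<in> ?r\<^sup>*" if [simp]: "h \<in> C" for h
  proof -
    obtain k where k: "k \<in> C" "V k = V g" "F k = F h"
      using V_F_surj[of g h] by auto
    then obtain i :: nat where "k = g \<otimes> y [^] i"
      using V_eq_iff[of g k] by auto
    then show ?thesis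
      using path[of i] k by simp
  qed
  moreover have "(E h, F g) \<in> ?r\<^sup>*" if "h \<in> C" "E h \<in> ?S" for h
    using that by (intro converse_rtrancl_into_rtrancl[OF _ F[of h]]) simp_all
  ultimately show "(u, F g) \<in> ?r\<^sup>*"
    using u neighbours_V[OF assms u] by auto
qed

lemma connected_face:
  assumes [simp]: "g \<in> C"
  shows "induced_connected P (neighbours P (F g))"
proof (rule induced_connectedI)
  let ?S = "neighbours P (F g)"
  let ?r = "{(u, v). u \<in> ?S \<and> v \<in> ?S \<and> v \<in> neighbours P u}"
  fix u assume u: "u \<in> ?S"
  \<comment> \<open>Walking around the face: with k = g x^(n+1), the edge of k joins the vertices of
    k and k x^-1.\<close>
  have path: "(V (g \<otimes> x [^] n), V g) \<in> ?r\<^sup>*" for n :: nat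
  proof (induction n)
    case (Suc n)
    define k where "k = g \<otimes> x [^] Suc n"
    have [simp]: "k \<in> C" "F k = F g"
      unfolding k_def using F_mult_x_pow[of g "Suc n"] by simp_all
    have "k = g \<otimes> x [^] n \<otimes> x"
      by (simp add: k_def m_assoc)
    then have [simp]: "k \<otimes> inv x = g \<otimes> x [^] n"
      by (simp add: m_assoc)
    have "(E k, V g) \<in> ?r\<^sup>*"
      by (rule converse_rtrancl_into_rtrancl[OF _ Suc]) simp
    then show ?case
      unfolding k_def[symmetric] by (rule converse_rtrancl_into_rtrancl[rotated]) simp
  qed simp
  have V: "(V h, V g) \<in> ?r\<^sup>*" if [simp]: "h \<in> C" for h
  proof -
    obtain k where k: "k \<in> C" "V k = V h" "F k = F g"
      using V_F_surj[of h g] by auto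
    then obtain i :: nat where "k = g \<otimes> x [^] i"
      using F_eq_iff[of g k] by auto
    then show ?thesis
      using path[of i] k by simp
  qed
  moreover have "(E h, V g) \<in> ?r\<^sup>*" if "h \<in> C" "E h \<in> ?S" for h
    using that by (intro converse_rtrancl_into_rtrancl[OF _ V[of h]]) simp_all
  ultimately show "(u, V g) \<in> ?r\<^sup>*"
    using u neighbours_F[OF assms u] by auto
qed

lemma polyhedron_P: "polyhedron P"
  unfolding polyhedron_def
proof (intro conjI ballI allI impI)
  show "rk P u \<in> {0, 1, 2}" for u
    by (simp add: P_def)
  show "rk P u < rk P w" if "(u, w) \<in> ord P \<and> u \<noteq> w" for u w
    using that by (auto simp: P_def)
  fix e assume "e \<in> of_rank P 1"
  then obtain h where [simp]: "h \<in> C" and e: "e = E h"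
    by (auto simp: of_rank_P)
  have "{v \<in> of_rank P 0. incident P v e} = {V h, V (h \<otimes> inv x)}"
    by (auto simp: of_rank_P e incident_V_E)
  then show "card {v \<in> of_rank P 0. incident P v e} = 2"
    using V_mult_inv_x_ne[of h] by auto
  have "{f \<in> of_rank P 2. incident P e f} = {F h, F (h \<otimes> y)}"
    by (auto simp: of_rank_P e incident_E_F)
  then show "card {f \<in> of_rank P 2. incident P e f} = 2"
    using F_mult_y_ne[of h] by auto
next
  fix v f assume "v \<in> of_rank P 0" "f \<in> of_rank P 2"
  then obtain g where [simp]: "g \<in> C" and "v = V g" "f = F g"
    using V_F_surj by (fastforce simp: of_rank_P)
  then show "card {e \<in> of_rank P 1. incident P v e \<and> incident P e f} = 2"
    using E_mult_x_ne[of g] by (auto simp: edges_at_vertex_face)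
next
  fix u assume "u \<in> of_rank P 0 \<union> of_rank P 2"
  then show "induced_connected P (neighbours P u)"
    using connected_vertex_figure connected_face by (auto simp: of_rank_P)
qed (rule partial_order_P connected_P)+

lemma has_type_P: "has_type P p q"
  unfolding has_type_def
proof (intro conjI ballI)
  fix f assume "f \<in> of_rank P 2"
  then obtain g where [simp]: "g \<in> C" and f: "f = F g"
    by (auto simp: of_rank_P)
  have "inj_on (\<lambda>i::nat. E (g \<otimes> x [^] i)) {..<p}"
  proof (rule inj_onI)
    fix i k :: nat assume ik: "i \<in> {..<p}" "k \<in> {..<p}" "E (g \<otimes> x [^] i) = E (g \<otimes> x [^] k)"
    then have "g \<otimes> x [^] i = g \<otimes> x [^] k"
      by (intro E_F_inj) simp_all
    then show "i = k"
      using ik x_pow_inj by simp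
  qed
  then show "card {e \<in> of_rank P 1. incident P e f} = p"
    by (simp add: f edges_at_face card_image)
next
  fix v assume "v \<in> of_rank P 0"
  then obtain g where [simp]: "g \<in> C" and v: "v = V g"
    by (auto simp: of_rank_P)
  have "inj_on (\<lambda>i::nat. E (g \<otimes> y [^] i)) {..<q}"
  proof (rule inj_onI)
    fix i k :: nat assume ik: "i \<in> {..<q}" "k \<in> {..<q}" "E (g \<otimes> y [^] i) = E (g \<otimes> y [^] k)"
    then have "g \<otimes> y [^] i = g \<otimes> y [^] k"
      by (intro E_V_inj) simp_all
    then show "i = k"
      using ik y_pow_inj by simp
  qed
  then show "card {e \<in> of_rank P 1. incident P v e} = q"
    by (simp add: v edges_at_vertex card_image)
qed

text \<open>The two flags at the vertex-face pair of g. Even flags are the translates of the base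
  flag under left multiplication; odd ones are their neighbours in rank 1. This accounts for 2pq
  flags.\<close>

definition even_flag where "even_flag g = (V g, E g, F g)"
definition odd_flag where "odd_flag g = (V g, E (g \<otimes> x), F g)"

lemma even_flag_inj: "g \<in> C \<Longrightarrow> h \<in> C \<Longrightarrow> even_flag g = even_flag h \<Longrightarrow> g = h"
  by (auto simp: even_flag_def intro: V_F_inj)

lemma odd_flag_inj: "g \<in> C \<Longrightarrow> h \<in> C \<Longrightarrow> odd_flag g = odd_flag h \<Longrightarrow> g = h"
  by (auto simp: odd_flag_def intro: V_F_inj)

lemma even_flag_ne_odd_flag: "g \<in> C \<Longrightarrow> h \<in> C \<Longrightarrow> even_flag g \<noteq> odd_flag h"
  using V_F_inj[of g h] E_mult_x_ne[of g] by (auto simp: even_flag_def odd_flag_def)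

lemma flags_P: "flags P = even_flag ` C \<union> odd_flag ` C"
proof
  show "flags P \<subseteq> even_flag ` C \<union> odd_flag ` C"
  proof
    fix \<Phi> assume "\<Phi> \<in> flags P"
    then obtain v e f where \<Phi>: "\<Phi> = (v, e, f)" "v \<in> of_rank P 0" "f \<in> of_rank P 2"
      "e \<in> {e \<in> of_rank P (Suc 0). incident P v e \<and> incident P e f}"
      by (auto simp: flags_def)
    then obtain g where g: "g \<in> C" and vf: "v = V g" "f = F g"
      using V_F_surj by (fastforce simp: of_rank_P)
    then have "e \<in> {E g, E (g \<otimes> x)}"
      using \<Phi>(4) by (simp only: vf edges_at_vertex_face)
    then show "\<Phi> \<in> even_flag ` C \<union> odd_flag ` C"
      using g by (auto simp: \<Phi>(1) vf even_flag_def odd_flag_def)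
  qed
  have "V (g \<otimes> x \<otimes> inv x) = V g" if "g \<in> C" for g
    using that by (simp add: m_assoc)
  then show "even_flag ` C \<union> odd_flag ` C \<subseteq> flags P"
    by (auto simp: flags_def even_flag_def odd_flag_def of_rank_P incident_V_E incident_E_F
        incident_V_F)
qed

text \<open>The edge is kept in ranks 0 and 2 because g x^-1 x = g and g (y x) represents the same
  edge as g. Composing adjacencies 1, 0 or 2, 1 then multiplies g on the right by x or y, which is
  the shape of the distinguished generators.\<close>

lemma is_adj_even_flag:
  assumes [simp]: "g \<in> C"
  shows "is_adj P 0 (even_flag g) (odd_flag (g \<otimes> inv x))"
    and "is_adj P 1 (even_flag g) (odd_flag g)"
    and "is_adj P 2 (even_flag g) (odd_flag (g \<otimes> y))"
  using V_mult_inv_x_ne[of g] F_mult_y_ne[of g] E_mult_x_ne[of g]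
  by (auto simp: is_adj_def flags_P) (auto simp: even_flag_def odd_flag_def m_assoc)

lemma is_adj_odd_flag:
  assumes [simp]: "g \<in> C"
  shows "is_adj P 0 (odd_flag g) (even_flag (g \<otimes> x))"
    and "is_adj P 1 (odd_flag g) (even_flag g)"
    and "is_adj P 2 (odd_flag g) (even_flag (g \<otimes> inv y))"
  using is_adj_even_flag(1)[of "g \<otimes> x"] is_adj_even_flag(2)[of g]
    is_adj_even_flag(3)[of "g \<otimes> inv y"]
  by (auto intro: is_adj_sym simp: m_assoc)

lemma adj_flags [simp]:
  assumes "g \<in> C"
  shows "adj P 0 (even_flag g) = odd_flag (g \<otimes> inv x)"
    and "adj P (Suc 0) (even_flag g) = odd_flag g"
    and "adj P 2 (even_flag g) = odd_flag (g \<otimes> y)"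
    and "adj P 0 (odd_flag g) = even_flag (g \<otimes> x)"
    and "adj P (Suc 0) (odd_flag g) = even_flag g"
    and "adj P 2 (odd_flag g) = even_flag (g \<otimes> inv y)"
  using is_adj_even_flag[OF assms] is_adj_odd_flag[OF assms] adj_eqI[OF polyhedron_P] by auto

lemma card_carrier: "card C = p * q"
proof -
  have "inj_on (\<lambda>(i, j). x [^] (i::nat) \<otimes> y [^] (j::nat)) ({..<p} \<times> {..<q})"
  proof (rule inj_onI; clarify)
    fix i j i' j' :: nat
    assume lt: "i < p" "i' < p" "j < q" "j' < q"
      and eq: "x [^] i \<otimes> y [^] j = x [^] i' \<otimes> y [^] j'"
    have "V (x [^] i) = V (x [^] i')"
      using V_mult_y_pow[of "x [^] i" j] V_mult_y_pow[of "x [^] i'" j'] by (simp add: eq)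
    moreover have "F (x [^] i) = F (x [^] i')"
      using F_mult_x_pow[of \<one> i] F_mult_x_pow[of \<one> i'] by simp
    ultimately have "x [^] i = x [^] i'"
      by (intro V_F_inj) simp_all
    with eq lt x_pow_inj[of i i'] y_pow_inj[of j j'] show "i = i' \<and> j = j'"
      by simp
  qed
  then show ?thesis
    by (subst carrier_eq) (simp add: card_image card_cartesian_product)
qed

lemma tight_P: "tight P p q"
proof -
  have "card (even_flag ` C \<union> odd_flag ` C) = card (even_flag ` C) + card (odd_flag ` C)"
    using even_flag_ne_odd_flag by (intro card_Un_disjoint) (blast intro: finite_imageI finite_carrier)+
  also have "\<dots> = 2 * p * q"
    by (simp add: card_image inj_on_def even_flag_inj odd_flag_inj card_carrier)
  finally show ?thesis
    by (simp add: tight_def flags_P finite_carrier)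
qed

end

section \<open>Left multiplication as automorphisms, and the rigidity of automorphisms\<close>

context coset_polyhedron
begin

text \<open>Left multiplication by k on cosets, computed on a chosen representative because the
  codes in 'b are opaque. The restriction to \<open>elems P\<close> makes the map extensional, as
  membership in \<open>Bij\<close> requires.\<close>

definition act :: "'a \<Rightarrow> 'b \<Rightarrow> 'b" where
  "act k = (\<lambda>u\<in>elems P. if u \<in> V ` C then V (k \<otimes> inv_into C V u)
     else if u \<in> E ` C then E (k \<otimes> inv_into C E u) else F (k \<otimes> inv_into C F u))"

lemma act_simps [simp]:
  assumes [simp]: "k \<in> C" "g \<in> C"
  shows "act k (V g) = V (k \<otimes> g)" "act k (E g) = E (k \<otimes> g)" "act k (F g) = F (k \<otimes> g)"
proof -
  have V: "V (k \<otimes> h) = V (k \<otimes> g)" if "h \<in> C" "V h = V g" for h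
    using that by (auto simp: V_eq_iff m_assoc)
  have E: "E (k \<otimes> h) = E (k \<otimes> g)" if "h \<in> C" "E h = E g" for h
    using that by (auto simp: E_eq_iff m_assoc)
  have F: "F (k \<otimes> h) = F (k \<otimes> g)" if "h \<in> C" "F h = F g" for h
    using that by (auto simp: F_eq_iff m_assoc)
  show "act k (V g) = V (k \<otimes> g)"
    using V[of "inv_into C V (V g)"] by (simp add: act_def elems_P inv_into_into f_inv_into_f)
  have "E g \<notin> V ` C" "F g \<notin> V ` C" "F g \<notin> E ` C"
    by (auto dest: distinct_ranks'[THEN notE])
  then show "act k (E g) = E (k \<otimes> g)" "act k (F g) = F (k \<otimes> g)"
    using E[of "inv_into C E (E g)"] F[of "inv_into C F (F g)"]
    by (simp_all add: act_def elems_P inv_into_into f_inv_into_f)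
qed

lemma act_closed: "k \<in> C \<Longrightarrow> u \<in> elems P \<Longrightarrow> act k u \<in> elems P"
  by (auto simp: elems_P)

lemma act_act: "k \<in> C \<Longrightarrow> l \<in> C \<Longrightarrow> u \<in> elems P \<Longrightarrow> act k (act l u) = act (k \<otimes> l) u"
  by (auto simp: elems_P m_assoc)

lemma act_one: "u \<in> elems P \<Longrightarrow> act \<one> u = u"
  by (auto simp: elems_P)

lemma act_ord: "k \<in> C \<Longrightarrow> (u, w) \<in> ord P \<Longrightarrow> (act k u, act k w) \<in> ord P"
  by (auto simp: P_def)

lemma act_in_poset_auts:
  assumes [simp]: "k \<in> C"
  shows "act k \<in> poset_auts P"
proof -
  have inv: "act (inv k) (act k u) = u" "act k (act (inv k) u) = u" if "u \<in> elems P" for u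
    using that by (simp_all add: act_act act_one)
  have "bij_betw (act k) (elems P) (elems P)"
    by (rule bij_betw_byWitness[of _ "act (inv k)"]) (auto simp: inv act_closed)
  moreover have "act k \<in> extensional (elems P)"
    by (simp add: act_def)
  moreover have "(act k u, act k w) \<in> ord P \<longleftrightarrow> (u, w) \<in> ord P"
    if "u \<in> elems P" "w \<in> elems P" for u w
    using act_ord[of k u w] act_ord[of "inv k" "act k u" "act k w"] that by (auto simp: inv)
  ultimately show ?thesis
    by (simp add: poset_auts_def Bij_def)
qed

lemma flag_map_act [simp]:
  assumes "k \<in> C" "g \<in> C"
  shows "flag_map (act k) (even_flag g) = even_flag (k \<otimes> g)"
    and "flag_map (act k) (odd_flag g) = odd_flag (k \<otimes> g)"
  using assms by (simp_all add: flag_map_def even_flag_def odd_flag_def m_assoc)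

lemma flag_map_even_step:
  assumes \<alpha>: "\<alpha> \<in> poset_auts P" and [simp]: "g \<in> C"
  shows "flag_map \<alpha> (even_flag (g \<otimes> x)) = adj P 0 (adj P 1 (flag_map \<alpha> (even_flag g)))"
    and "flag_map \<alpha> (even_flag (g \<otimes> y)) = adj P 1 (adj P 2 (flag_map \<alpha> (even_flag g)))"
  using adj_flag_map[OF polyhedron_P \<alpha> is_adj_even_flag(2)[of g]]
    adj_flag_map[OF polyhedron_P \<alpha> is_adj_odd_flag(1)[of g]]
    adj_flag_map[OF polyhedron_P \<alpha> is_adj_even_flag(3)[of g]]
    adj_flag_map[OF polyhedron_P \<alpha> is_adj_odd_flag(2)[of "g \<otimes> y"]]
  by simp_all

lemma flag_map_even_pow:
  assumes \<alpha>: "\<alpha> \<in> poset_auts P" and [simp]: "g \<in> C" "k \<in> C"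
    and "flag_map \<alpha> (even_flag g) = even_flag k"
  shows "flag_map \<alpha> (even_flag (g \<otimes> (x [^] (i::nat) \<otimes> y [^] (j::nat)))) = even_flag (k \<otimes> (x [^] i \<otimes> y [^] j))"
proof -
  have "flag_map \<alpha> (even_flag (g \<otimes> x [^] i)) = even_flag (k \<otimes> x [^] i)"
  proof (induction i)
    case (Suc i)
    then show ?case
      using flag_map_even_step(1)[OF \<alpha>, of "g \<otimes> x [^] i"] by (simp add: m_assoc)
  qed (simp add: assms)
  then have "flag_map \<alpha> (even_flag (g \<otimes> x [^] i \<otimes> y [^] j)) = even_flag (k \<otimes> x [^] i \<otimes> y [^] j)"
  proof (induction j)
    case (Suc j)
    then show ?case
      using flag_map_even_step(2)[OF \<alpha>, of "g \<otimes> x [^] i \<otimes> y [^] j"] by (simp add: m_assoc)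
  qed simp
  then show ?thesis
    by (simp add: m_assoc)
qed

text \<open>From \<open>odd_flag k\<close> the two double adjacencies lead through
  \<open>even_flag k\<close> to k x^-1, and through the even flag of k y^-1 to the odd flag of k
  y^-1. Steps that multiply by x and y on even flags thus multiply by their inverses on odd
  ones.\<close>

lemma flag_map_odd_pow:
  assumes \<alpha>: "\<alpha> \<in> poset_auts P" and [simp]: "g \<in> C" "k \<in> C"
    and "flag_map \<alpha> (even_flag g) = odd_flag k"
  shows "flag_map \<alpha> (even_flag (g \<otimes> (x [^] (i::nat) \<otimes> y [^] (j::nat))))
    = odd_flag (k \<otimes> (inv x [^] i \<otimes> inv y [^] j))"
proof -
  have "flag_map \<alpha> (even_flag (g \<otimes> x [^] i)) = odd_flag (k \<otimes> inv x [^] i)"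
  proof (induction i)
    case (Suc i)
    then show ?case
      using flag_map_even_step(1)[OF \<alpha>, of "g \<otimes> x [^] i"] by (simp add: m_assoc)
  qed (simp add: assms)
  then have "flag_map \<alpha> (even_flag (g \<otimes> x [^] i \<otimes> y [^] j)) = odd_flag (k \<otimes> inv x [^] i \<otimes> inv y [^] j)"
  proof (induction j)
    case (Suc j)
    then show ?case
      using flag_map_even_step(2)[OF \<alpha>, of "g \<otimes> x [^] i \<otimes> y [^] j"] by (simp add: m_assoc)
  qed simp
  then show ?thesis
    by (simp add: m_assoc)
qed

text \<open>The image of one flag determines an automorphism: double adjacencies commute with it and
  reach every even flag from the base flag, and even flags contain every element.\<close>

lemma aut_eq_act:
  assumes \<alpha>: "\<alpha> \<in> poset_auts P" and [simp]: "k \<in> C"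
    and eq: "flag_map \<alpha> (even_flag \<one>) = even_flag k"
  shows "\<alpha> = act k"
proof (rule extensionalityI)
  show "\<alpha> \<in> extensional (elems P)" "act k \<in> extensional (elems P)"
    using \<alpha> act_in_poset_auts[of k] by (auto simp: poset_auts_def Bij_def)
  have "flag_map \<alpha> (even_flag g) = even_flag (k \<otimes> g)" if "g \<in> C" for g
    using product_of_powers[OF that] flag_map_even_pow[OF \<alpha> _ _ eq] by auto
  then show "\<alpha> u = act k u" if "u \<in> elems P" for u
    using that by (auto simp: elems_P flag_map_def even_flag_def)
qed

text \<open>An automorphism exchanging the two classes of flags is the reflection fixing the base vertex
  and the base face, up to a rotation, so conjugation by it inverts both generators.\<close>

lemma even_to_odd_imp_inverting_hom:
  assumes \<alpha>: "\<alpha> \<in> poset_auts P" and [simp]: "k \<in> C"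
    and eq: "flag_map \<alpha> (even_flag \<one>) = odd_flag k"
  shows "\<exists>\<phi>\<in>hom G G. \<phi> x = inv x \<and> \<phi> y = inv y"
proof -
  \<comment> \<open>Reading the value off the image flag makes it independent of how g is written as
    x^i y^j; uniqueness comes from \<open>odd_flag_inj\<close>.\<close>
  define \<phi> where "\<phi> g = (THE h. h \<in> C \<and> flag_map \<alpha> (even_flag g) = odd_flag (k \<otimes> h))" for g
  have \<phi>_eq: "\<phi> g = h" if "h \<in> C" "flag_map \<alpha> (even_flag g) = odd_flag (k \<otimes> h)" for g h
    unfolding \<phi>_def
  proof (rule the_equality)
    show "h' = h" if "h' \<in> C \<and> flag_map \<alpha> (even_flag g) = odd_flag (k \<otimes> h')" for h'
      using that \<open>h \<in> C\<close> \<open>flag_map \<alpha> (even_flag g) = _\<close> odd_flag_inj[of "k \<otimes> h'" "k \<otimes> h"] by simp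
  qed (use that in simp)
  have pow: "\<phi> (x [^] i \<otimes> y [^] j) = inv x [^] i \<otimes> inv y [^] j" for i j :: nat
    using flag_map_odd_pow[OF \<alpha> _ _ eq, of i j] by (intro \<phi>_eq) simp_all
  have \<phi>: "\<phi> g \<in> C \<and> flag_map \<alpha> (even_flag g) = odd_flag (k \<otimes> \<phi> g)" if "g \<in> C" for g
  proof -
    obtain i j :: nat where g: "g = x [^] i \<otimes> y [^] j"
      using product_of_powers \<open>g \<in> C\<close> by blast
    show ?thesis
      using flag_map_odd_pow[OF \<alpha> _ _ eq, of i j] by (simp add: g pow)
  qed
  have "\<phi> \<in> hom G G"
  proof (rule homI)
    fix g h assume [simp]: "g \<in> C" and h: "h \<in> C"
    obtain i j :: nat where h: "h = x [^] i \<otimes> y [^] j"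
      using product_of_powers[OF h] by blast
    \<comment> \<open>Multiplicativity: the walk spelled by h is started at the flag of g instead of
      the base flag.\<close>
    have "flag_map \<alpha> (even_flag (g \<otimes> h)) = odd_flag (k \<otimes> \<phi> g \<otimes> (inv x [^] i \<otimes> inv y [^] j))"
      unfolding h using \<phi>[of g] by (intro flag_map_odd_pow[OF \<alpha>]) simp_all
    then show "\<phi> (g \<otimes> h) = \<phi> g \<otimes> \<phi> h"
      using \<phi>[of g] by (intro \<phi>_eq) (simp_all add: h pow m_assoc)
  qed (use \<phi> in simp)
  moreover have "\<phi> x = inv x" "\<phi> y = inv y"
    using pow[of 1 0] pow[of 0 1] by simp_all
  ultimately show ?thesis by blast
qed

end

section \<open>Chirality and the full automorphism group\<close>

locale chiral_coset_polyhedron = coset_polyhedron +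
  assumes no_inverting_hom: "\<not> (\<exists>\<phi>\<in>hom G G. \<phi> x = inv x \<and> \<phi> y = inv y)"
begin

lemma flag_map_base_even:
  assumes "\<alpha> \<in> poset_auts P"
  obtains k where "k \<in> C" "flag_map \<alpha> (even_flag \<one>) = even_flag k"
proof -
  have "flag_map \<alpha> (even_flag \<one>) \<in> flags P"
    by (rule flag_map_in_flags[OF polyhedron_P assms]) (simp add: flags_P)
  then show ?thesis
    using that even_to_odd_imp_inverting_hom[OF assms] no_inverting_hom by (auto simp: flags_P)
qed

lemma chiral_P: "chiral P"
  unfolding chiral_def
proof (intro conjI exI)
  show "even_flag ` C \<union> odd_flag ` C = flags P"
    by (simp add: flags_P)
  show "even_flag ` C \<inter> odd_flag ` C = {}"
    using even_flag_ne_odd_flag by blast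
  have ne: "even_flag g \<notin> odd_flag ` C" "odd_flag g \<notin> even_flag ` C" if "g \<in> C" for g
    using that even_flag_ne_odd_flag by (blast, metis imageE)
  show "\<forall>\<Phi>\<in>flags P. \<forall>i\<in>{0, 1, 2}. (adj P i \<Phi> \<in> even_flag ` C) = (\<Phi> \<in> odd_flag ` C)"
  proof (intro ballI)
    fix \<Phi> and i :: nat
    assume "\<Phi> \<in> flags P" and i: "i \<in> {0, 1, 2}"
    then consider g where "g \<in> C" "\<Phi> = even_flag g" | g where "g \<in> C" "\<Phi> = odd_flag g"
      by (auto simp: flags_P)
    then show "(adj P i \<Phi> \<in> even_flag ` C) = (\<Phi> \<in> odd_flag ` C)"
      using i by cases (auto simp: ne even_flag_ne_odd_flag[symmetric])
  qed
  have "\<exists>\<alpha>\<in>poset_auts P. flag_map \<alpha> (even_flag g) = even_flag h"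
    and "\<exists>\<alpha>\<in>poset_auts P. flag_map \<alpha> (odd_flag g) = odd_flag h" if "g \<in> C" "h \<in> C" for g h
    using that by (auto intro!: bexI[OF _ act_in_poset_auts[of "h \<otimes> inv g"]] simp: m_assoc)
  then show "flag_transitive_on P (even_flag ` C)" "flag_transitive_on P (odd_flag ` C)"
    by (auto simp: flag_transitive_on_def)
  show "\<not> flag_transitive_on P (flags P)"
  proof
    assume "flag_transitive_on P (flags P)"
    moreover have "even_flag \<one> \<in> flags P" "odd_flag \<one> \<in> flags P"
      by (simp_all add: flags_P)
    ultimately obtain \<alpha> where "\<alpha> \<in> poset_auts P" "flag_map \<alpha> (even_flag \<one>) = odd_flag \<one>"
      unfolding flag_transitive_on_def by blast
    then show False
      using even_to_odd_imp_inverting_hom[of \<alpha> \<one>] no_inverting_hom by simp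
  qed
qed

text \<open>Surjectivity is where chirality enters: the base flag can only be sent to an even flag,
  and there \<open>aut_eq_act\<close> identifies the automorphism.\<close>

lemma act_iso: "act \<in> iso G (aut_group P)"
proof (rule isoI)
  have "act (k \<otimes> l) = compose (elems P) (act k) (act l)" if "k \<in> C" "l \<in> C" for k l
  proof (rule extensionalityI[of _ "elems P"])
    show "act (k \<otimes> l) \<in> extensional (elems P)"
      by (simp add: act_def)
  qed (use that in \<open>simp_all add: compose_def act_act\<close>)
  then show "act \<in> hom G (aut_group P)"
    using act_in_poset_auts
    by (auto simp: hom_def aut_group_def BijGroup_def poset_auts_def)
  have "inj_on act C"
    by (rule inj_onI) (metis even_flag_inj flag_map_act(1) one_closed r_one)
  moreover have "act ` C = poset_auts P"
  proof
    show "poset_auts P \<subseteq> act ` C"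
      using aut_eq_act by (metis flag_map_base_even image_eqI subsetI)
  qed (use act_in_poset_auts in blast)
  ultimately show "bij_betw act (carrier G) (carrier (aut_group P))"
    by (simp add: bij_betw_def aut_group_def)
qed

lemma is_aut_group_of_P: "is_aut_group_of G x y P"
  unfolding is_aut_group_of_def
proof (intro bexI conjI)
  show "even_flag \<one> \<in> flags P"
    by (simp add: flags_P)
  show "act \<in> iso G (aut_group P)"
    by (rule act_iso)
qed simp_all

end

lemma (in tight_generators) coset_polyhedron_exists:
  assumes "\<not> (\<exists>\<phi>\<in>hom G G. \<phi> x = inv x \<and> \<phi> y = inv y)"
  shows "\<exists>P :: nat ranked_poset. polyhedron P \<and> has_type P p q \<and> tight P p q \<and> chiral P \<and>
    is_aut_group_of G x y P"
proof -
  \<comment> \<open>Finiteness lets subsets be numbered. The residue modulo 3 of the final code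
    records the rank, which keeps the three kinds of coset apart.\<close>
  obtain c :: "'a set \<Rightarrow> nat" where c: "inj_on c (Pow (carrier G))"
    using finite_carrier by (meson finite_Pow_iff finite_imp_inj_to_nat_seg)
  define VC where "VC g = range (\<lambda>i::nat. g \<otimes> y [^] i)" for g
  define EC where "EC g = {g, g \<otimes> (y \<otimes> x)}" for g
  define FC where "FC g = range (\<lambda>i::nat. g \<otimes> x [^] i)" for g
  define V where "V g = 3 * c (VC g)" for g
  define E where "E g = 3 * c (EC g) + 1" for g
  define F where "F g = 3 * c (FC g) + 2" for g
  have "(y \<otimes> x) \<otimes> (y \<otimes> x) = inv x \<otimes> inv y \<otimes> (y \<otimes> x)"
    by (simp add: yx)
  also have "\<dots> = \<one>"
    by (simp add: inv_mult_group[symmetric])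
  finally have yxyx: "(y \<otimes> x) \<otimes> (y \<otimes> x) = \<one>" .
  have c_eq: "c A = c B \<longleftrightarrow> A = B" if "A \<subseteq> carrier G" "B \<subseteq> carrier G" for A B
    using c that by (auto dest: inj_onD)
  interpret chiral_coset_polyhedron G x y p q V E F
  proof
    fix g h assume [simp]: "g \<in> carrier G" "h \<in> carrier G"
    have "V g = V h \<longleftrightarrow> VC g = VC h"
      unfolding V_def by (subst c_eq[symmetric]) (auto simp: VC_def)
    then show "V g = V h \<longleftrightarrow> (\<exists>i::nat. h = g \<otimes> y [^] i)"
      unfolding VC_def using q_gt_1 by (simp add: pow_coset_eq_iff[where n = q] y_pow_eq_one_iff)
    have "F g = F h \<longleftrightarrow> FC g = FC h"
      unfolding F_def by (subst c_eq[symmetric]) (auto simp: FC_def)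
    then show "F g = F h \<longleftrightarrow> (\<exists>i::nat. h = g \<otimes> x [^] i)"
      unfolding FC_def using p_gt_1 by (simp add: pow_coset_eq_iff[where n = p] x_pow_eq_one_iff)
    have "E g = E h \<longleftrightarrow> EC g = EC h"
      unfolding E_def by (subst c_eq[symmetric]) (auto simp: EC_def)
    also have "\<dots> \<longleftrightarrow> h = g \<or> h = g \<otimes> (y \<otimes> x)"
    proof
      show "EC g = EC h" if "h = g \<or> h = g \<otimes> (y \<otimes> x)"
      proof -
        have "g \<otimes> (y \<otimes> x) \<otimes> (y \<otimes> x) = g"
          using yxyx by (subst m_assoc) simp_all
        then show ?thesis
          using that by (auto simp: EC_def)
      qed
    qed (auto simp: EC_def)
    finally show "E g = E h \<longleftrightarrow> h = g \<or> h = g \<otimes> (y \<otimes> x)" .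
  next
    fix g h
    have "V g mod 3 = 0" "E h mod 3 = 1" "E g mod 3 = 1" "F h mod 3 = 2"
      unfolding V_def E_def F_def by presburger+
    then show "V g \<noteq> E h" "V g \<noteq> F h" "E g \<noteq> F h"
      by auto
  qed (rule assms)
  show ?thesis
    using polyhedron_P has_type_P tight_P chiral_P is_aut_group_of_P by blast
qed


section \<open>Consequences of the relations\<close>

context group
begin

text \<open>The hypothesis says that conjugation by a sends b to c, and conjugation is a
  homomorphism.\<close>

lemma semiconj_int_pow:
  fixes k :: int
  assumes [simp]: "a \<in> carrier G" "b \<in> carrier G" "c \<in> carrier G"
    and eq: "a \<otimes> b = c \<otimes> a"
  shows "a \<otimes> b [^] k = c [^] k \<otimes> a"
proof -
  let ?h = "\<lambda>w. a \<otimes> w \<otimes> inv a"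
  have "?h \<in> hom G G"
    by (rule homI) (simp_all add: m_assoc inv_solve_left)
  moreover have "?h b = c"
    by (simp add: eq m_assoc)
  ultimately have "?h (b [^] k) = c [^] k"
    using hom_int_pow[of ?h G G b k] is_group by simp
  then have "c [^] k \<otimes> a = ?h (b [^] k) \<otimes> a"
    by simp
  then show ?thesis
    by (simp add: m_assoc)
qed

lemma commute_int_pow:
  fixes j k :: int
  assumes [simp]: "a \<in> carrier G" "b \<in> carrier G" and "a \<otimes> b = b \<otimes> a"
  shows "a [^] j \<otimes> b [^] k = b [^] k \<otimes> a [^] j"
proof -
  have "b [^] k \<otimes> a = a \<otimes> b [^] k"
    using assms semiconj_int_pow[of a b b k] by simp
  then show ?thesis
    using semiconj_int_pow[of "b [^] k" a a j] by simp
qed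

lemma int_pow_eq_if_dvd:
  fixes i j n :: int
  assumes [simp]: "a \<in> carrier G" and "a [^] n = \<one>" and "n dvd i - j"
  shows "a [^] i = a [^] j"
proof -
  obtain k where k: "i = j + n * k"
    using assms(3) by (metis dvdE diff_eq_eq add.commute)
  have "a [^] (n * k) = \<one>"
    using assms(2) int_pow_pow[of a n k] by simp
  then show ?thesis
    by (simp add: k int_pow_mult)
qed

end

locale tight_relations = group G for G (structure) +
  fixes x y :: 'a and t T :: int
  assumes x_closed [simp]: "x \<in> carrier G"
    and y_closed [simp]: "y \<in> carrier G"
    and T_cases: "T = t \<or> T = - t"
    and x_ord: "x [^] (16 * t) = \<one>"
    and y_ord: "y [^] (32 * t) = \<one>"
    and xyxy: "x \<otimes> (y \<otimes> (x \<otimes> y)) = \<one>"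
    and rel1: "inv y \<otimes> x = x [^] (8 * t - 1) \<otimes> y [^] (8 * T - 3)"
    and rel2: "y \<otimes> inv x = x [^] (1 - 8 * t) \<otimes> y [^] (8 * T + 3)"
begin

lemma x_pow_eq: "16 * t dvd i - j \<Longrightarrow> x [^] i = x [^] j" for i j :: int
  using int_pow_eq_if_dvd x_closed x_ord by blast

lemma y_pow_eq: "32 * t dvd i - j \<Longrightarrow> y [^] i = y [^] j" for i j :: int
  using int_pow_eq_if_dvd y_closed y_ord by blast

lemma x_pow_mult: "x [^] i \<otimes> (x [^] j \<otimes> w) = x [^] (i + j) \<otimes> w" if "w \<in> carrier G" for i j :: int
  using that by (simp add: int_pow_mult m_assoc)

lemma y_pow_mult: "y [^] i \<otimes> (y [^] j \<otimes> w) = y [^] (i + j) \<otimes> w" if "w \<in> carrier G" for i j :: int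
  using that by (simp add: int_pow_mult m_assoc)

lemma x_mult_pow: "x \<otimes> x [^] j = x [^] (j + 1)" "x [^] j \<otimes> x = x [^] (j + 1)"
  "w \<in> carrier G \<Longrightarrow> x \<otimes> (x [^] j \<otimes> w) = x [^] (j + 1) \<otimes> w" for j :: int
  using int_pow_mult[of x 1 j] int_pow_mult[of x j 1]
  by (simp_all add: add.commute m_assoc[symmetric])

lemma y_mult_pow: "y \<otimes> y [^] j = y [^] (j + 1)" "y [^] j \<otimes> y = y [^] (j + 1)"
  "w \<in> carrier G \<Longrightarrow> y \<otimes> (y [^] j \<otimes> w) = y [^] (j + 1) \<otimes> w" for j :: int
  using int_pow_mult[of y 1 j] int_pow_mult[of y j 1]
  by (simp_all add: add.commute m_assoc[symmetric])

lemmas pow_collect = x_pow_mult y_pow_mult x_mult_pow y_mult_pow int_pow_mult[symmetric] m_assoc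

lemma inv_x: "inv x = y \<otimes> (x \<otimes> y)"
  using xyxy by (intro inv_equality inv_comm[of x]) (auto simp: m_assoc)

lemma inv_y: "inv y = x \<otimes> (y \<otimes> x)"
proof -
  have "y \<otimes> (x \<otimes> (y \<otimes> x)) = inv x \<otimes> x"
    by (simp add: inv_x m_assoc)
  then show ?thesis
    by (intro inv_equality inv_comm[of y]) (auto simp: m_assoc)
qed

lemma yx: "y \<otimes> x = inv x \<otimes> inv y"
  by (simp add: inv_x m_assoc)

lemma y_pow_2: "y [^] (2::int) = y \<otimes> y" and x_pow_2: "x [^] (2::int) = x \<otimes> x"
  using int_pow_mult[of y 1 1] int_pow_mult[of x 1 1] by simp_all

lemma y2x: "y [^] (2::int) \<otimes> x = x [^] (1 - 8 * t) \<otimes> y [^] (8 * T + 2)"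
proof -
  have "y [^] (2::int) \<otimes> x = y \<otimes> inv x \<otimes> inv y"
    by (simp add: y_pow_2 m_assoc yx)
  also have "\<dots> = x [^] (1 - 8 * t) \<otimes> y [^] (8 * T + 3) \<otimes> y [^] (- 1 :: int)"
    by (simp add: rel2 int_pow_neg)
  finally show ?thesis
    by (simp add: pow_collect add.commute)
qed

text \<open>This is the inverse of the first special relation, after replacing x^-1 by y x y and
  cancelling y. \<open>y2x\<close> comes in the same way from the second one.\<close>

lemma xy2: "x \<otimes> y [^] (2::int) = y [^] (2 - 8 * T) \<otimes> x [^] (1 - 8 * t)"
proof -
  have "inv x \<otimes> y = inv (inv y \<otimes> x)"
    by (simp add: inv_mult_group)
  also have "\<dots> = y [^] (3 - 8 * T) \<otimes> x [^] (1 - 8 * t)"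
    using int_pow_neg[of x "8 * t - 1"] int_pow_neg[of y "8 * T - 3"]
    by (simp add: rel1 inv_mult_group)
  finally have "y \<otimes> (x \<otimes> y [^] (2::int)) = y \<otimes> (y [^] (2 - 8 * T) \<otimes> x [^] (1 - 8 * t))"
    by (simp add: inv_x y_pow_2 m_assoc y_mult_pow)
  then show ?thesis
    by simp
qed

lemma yx2: "y \<otimes> x [^] (2::int) = x [^] (8 * t - 2) \<otimes> y [^] (8 * T - 3)"
proof -
  have "x \<otimes> (y \<otimes> x [^] (2::int)) = inv y \<otimes> x"
    by (simp add: inv_y x_pow_2 m_assoc)
  also have "\<dots> = x \<otimes> (x [^] (8 * t - 2) \<otimes> y [^] (8 * T - 3))"
    by (simp add: rel1 x_mult_pow)
  finally show ?thesis
    by simp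
qed

section \<open>The involution z and the conjugates of y^2\<close>

definition z where "z = x [^] (8 * t)"
definition v where "v = y [^] (2::int)"
text \<open>This is the conjugate x^-1 y^2 x, by \<open>xu\<close>; hence its order divides that of
  y^2.\<close>

definition u where "u = z \<otimes> y [^] (8 * T + 2)"

lemma z_closed [simp]: "z \<in> carrier G" and v_closed [simp]: "v \<in> carrier G"
  and u_closed [simp]: "u \<in> carrier G"
  by (simp_all add: z_def v_def u_def)

lemma v_pow: "v [^] k = y [^] (2 * k)" for k :: int
  by (simp add: v_def int_pow_pow)

lemma zz: "z \<otimes> z = \<one>"
  by (simp add: z_def int_pow_mult[symmetric] x_ord)

lemma zz': "w \<in> carrier G \<Longrightarrow> z \<otimes> (z \<otimes> w) = w"
  using zz by (simp add: m_assoc[symmetric])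

lemma zx: "z \<otimes> x = x \<otimes> z"
  by (simp add: z_def x_mult_pow)

lemma x_pow_1_minus: "x [^] (1 - 8 * t) = x \<otimes> z"
  unfolding z_def x_mult_pow by (rule x_pow_eq) simp

lemma xu: "x \<otimes> u = v \<otimes> x"
  using y2x by (simp add: u_def v_def x_pow_1_minus m_assoc)

lemma u_pow_ord: "u [^] (16 * t) = \<one>"
proof -
  have "x \<otimes> u [^] (16 * t) = v [^] (16 * t) \<otimes> x"
    by (rule semiconj_int_pow) (simp_all add: xu)
  also have "v [^] (16 * t) = \<one>"
    by (simp add: v_pow y_ord)
  finally show ?thesis
    by simp
qed

text \<open>\<open>xy2\<close> gives x v = v^(1-4T) x z, and \<open>xu\<close> moves the power of v
  back past x as a power of u. Both directions of conjugation by x are combined here.\<close>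

lemma vz: "v \<otimes> z = u [^] (1 - 4 * T)"
proof -
  have "x \<otimes> v = v [^] (1 - 4 * T) \<otimes> x \<otimes> z"
    using xy2 by (simp add: v_pow x_pow_1_minus m_assoc) (simp add: v_def)
  also have "\<dots> = x \<otimes> (u [^] (1 - 4 * T) \<otimes> z)"
    using semiconj_int_pow[OF x_closed u_closed v_closed xu, of "1 - 4 * T"]
    by (simp add: m_assoc[symmetric])
  finally have "v = u [^] (1 - 4 * T) \<otimes> z"
    by simp
  then have "v \<otimes> z = u [^] (1 - 4 * T) \<otimes> z \<otimes> z"
    by simp
  then show ?thesis
    by (simp add: m_assoc zz)
qed

text \<open>As a power of u, v z commutes with u = z y^(8T+2). Cancelling z^2 leaves z commuting
  with y^(8T+4), of which y^4 is a power.\<close>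

lemma z_commute_y4: "z \<otimes> y [^] (4::int) = y [^] (4::int) \<otimes> z"
proof -
  have "v \<otimes> z \<otimes> u = u \<otimes> (v \<otimes> z)"
    unfolding vz using int_pow_mult[of u "1 - 4 * T" 1] int_pow_mult[of u 1 "1 - 4 * T"]
    by (simp add: add.commute)
  then have "v \<otimes> y [^] (8 * T + 2) = z \<otimes> (y [^] (8 * T + 2) \<otimes> v \<otimes> z)"
    by (simp add: u_def m_assoc zz')
  then have "y [^] (8 * T + 4) = z \<otimes> (y [^] (8 * T + 4) \<otimes> z)"
    by (simp add: v_def int_pow_mult[symmetric] add_ac)
  then have "z \<otimes> y [^] (8 * T + 4) = z \<otimes> (z \<otimes> (y [^] (8 * T + 4) \<otimes> z))"
    by simp
  then have comm: "z \<otimes> y [^] (8 * T + 4) = y [^] (8 * T + 4) \<otimes> z"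
    by (simp add: zz')
  \<comment> \<open>An inverse of 1 + 2T modulo 8t, since (1 + 2T) r = 1 - 16 T^4.\<close>
  let ?r = "(1 - 2 * T) * (1 + 4 * T * T)"
  have "32 * t dvd (8 * T + 4) * ?r - 4"
  proof -
    have "(8 * T + 4) * ?r - 4 = - 32 * T * (2 * T ^ 3)"
      by (simp add: algebra_simps power3_eq_cube)
    then show ?thesis using T_cases by auto
  qed
  then have "y [^] (4::int) = (y [^] (8 * T + 4)) [^] ?r"
    unfolding int_pow_pow[OF y_closed] by (rule y_pow_eq[symmetric])
  moreover have "z \<otimes> (y [^] (8 * T + 4)) [^] ?r = (y [^] (8 * T + 4)) [^] ?r \<otimes> z"
    by (rule semiconj_int_pow[OF z_closed _ _ comm]) simp_all
  ultimately show ?thesis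
    by metis
qed

lemma z_commute_y4_pow: "z \<otimes> y [^] (4 * k) = y [^] (4 * k) \<otimes> z" for k :: int
  using semiconj_int_pow[OF z_closed _ _ z_commute_y4, of k] by (simp add: int_pow_pow)

text \<open>The relation $u^{2 - 4T} = v^{2 + 4T}$ gives $u^2 = v^{2 + 8T}$ because $1 - 2T$ is
  invertible modulo $8t$; this is where $\beta \geq 5$ is needed.\<close>

lemma z_commute_v: "z \<otimes> v = v \<otimes> z"
proof -
  let ?r = "(1 + 2 * T) * (1 + 4 * T * T)"
  have y8T: "y [^] (8 * T) \<otimes> z = z \<otimes> y [^] (8 * T)"
    using z_commute_y4_pow[of "2 * T"] by simp
  have u: "u = z \<otimes> v \<otimes> y [^] (8 * T)"
    by (simp add: u_def v_def int_pow_mult[symmetric] m_assoc add.commute)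
  have "u [^] (2 - 4 * T) = v \<otimes> z \<otimes> u"
    unfolding vz using int_pow_mult[of u "1 - 4 * T" 1] by simp
  also have "\<dots> = v [^] (2 + 4 * T)"
    by (simp add: u m_assoc zz' v_pow) (simp add: v_def int_pow_mult[symmetric])
  finally have "(u [^] (2 - 4 * T)) [^] ?r = v [^] ((2 + 4 * T) * ?r)"
    by (simp add: int_pow_pow)
  moreover have "(u [^] (2 - 4 * T)) [^] ?r = u [^] (2::int)"
    unfolding int_pow_pow[OF u_closed]
  proof (rule int_pow_eq_if_dvd[OF u_closed u_pow_ord])
    have "(2 - 4 * T) * ?r - 2 = - 16 * T * (2 * T ^ 3)"
      by (simp add: algebra_simps power3_eq_cube)
    then show "16 * t dvd (2 - 4 * T) * ?r - 2" using T_cases by auto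
  qed
  moreover have "v [^] ((2 + 4 * T) * ?r) = v [^] (2 + 8 * T)"
    unfolding v_pow
  proof (rule y_pow_eq)
    have "2 * ((2 + 4 * T) * ?r) - 2 * (2 + 8 * T) = 32 * T * (T + 2 * T ^ 2 + 2 * T ^ 3)"
      by (simp add: algebra_simps power2_eq_square power3_eq_cube)
    then show "32 * t dvd 2 * ((2 + 4 * T) * ?r) - 2 * (2 + 8 * T)" using T_cases by auto
  qed
  ultimately have "u [^] (2::int) = v \<otimes> v \<otimes> y [^] (16 * T)"
    by (simp add: v_pow) (simp add: v_def int_pow_mult[symmetric])
  \<comment> \<open>A second evaluation of u^2, from u = z v y^(8T): the last factor is a power of
    y^4 and moves past both z and v. Comparison with the first yields z v z = v.\<close>
  moreover have "u [^] (2::int) = z \<otimes> v \<otimes> z \<otimes> v \<otimes> y [^] (16 * T)"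
  proof -
    have "y [^] (8 * T) \<otimes> v = v \<otimes> y [^] (8 * T)"
      by (simp add: v_def int_pow_mult[symmetric] add.commute)
    then have "y [^] (8 * T) \<otimes> (z \<otimes> (v \<otimes> y [^] (8 * T))) = z \<otimes> (v \<otimes> y [^] (16 * T))"
      using y8T by (simp add: m_assoc[symmetric]) (simp add: m_assoc int_pow_mult[symmetric])
    then show ?thesis
      using int_pow_mult[of u 1 1] by (simp add: u m_assoc)
  qed
  ultimately have "z \<otimes> v \<otimes> z = v"
    by simp
  then have "z \<otimes> v \<otimes> z \<otimes> z = v \<otimes> z"
    by simp
  then show ?thesis
    by (simp add: m_assoc zz)
qed

text \<open>Conjugation by x sends v to v^(1-4T) z. Now that z commutes with v, squaring removes the
  involution.\<close>

lemma xy4: "x \<otimes> y [^] (4::int) = y [^] (4 - 16 * T) \<otimes> x"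
proof -
  have "x \<otimes> v = v [^] (1 - 4 * T) \<otimes> z \<otimes> x"
    using xy2 by (simp add: v_pow x_pow_1_minus m_assoc zx) (simp add: v_def)
  then have "x \<otimes> v [^] (2::int) = (v [^] (1 - 4 * T) \<otimes> z) [^] (2::int) \<otimes> x"
    by (intro semiconj_int_pow) simp_all
  also have "(v [^] (1 - 4 * T) \<otimes> z) [^] (2::int) = v [^] (2 - 8 * T)"
  proof -
    have "v [^] (1 - 4 * T) \<otimes> z = z \<otimes> v [^] (1 - 4 * T)"
      by (rule semiconj_int_pow[symmetric]) (simp_all add: z_commute_v)
    then have "(v [^] (1 - 4 * T) \<otimes> z) [^] (2::int) = (v [^] (1 - 4 * T)) [^] (2::int) \<otimes> z [^] (2::int)"
      by (intro int_pow_mult_distrib) simp_all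
    moreover have "z [^] (2::int) = \<one>"
      using int_pow_mult[of z 1 1] zz by simp
    ultimately show ?thesis
      by (simp add: int_pow_pow)
  qed
  finally show ?thesis
    by (simp add: v_pow)
qed

lemma xy4_pow: "x \<otimes> y [^] (4 * k) = y [^] ((4 - 16 * T) * k) \<otimes> x" for k :: int
  using semiconj_int_pow[OF x_closed _ _ xy4, of k] by (simp add: int_pow_pow)

text \<open>Conjugation by x multiplies exponents on <y^4> by 1 - 4T, and 4 (1 - 4T)^2 is 4 modulo
  32t.\<close>

lemma x2_commute_y4: "x [^] (2::int) \<otimes> y [^] (4::int) = y [^] (4::int) \<otimes> x [^] (2::int)"
proof -
  have "x [^] (2::int) \<otimes> y [^] (4::int) = x \<otimes> y [^] (4 * (1 - 4 * T)) \<otimes> x"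
    by (simp add: x_pow_2 xy4 m_assoc)
  also have "\<dots> = y [^] ((4 - 16 * T) * (1 - 4 * T)) \<otimes> x [^] (2::int)"
    by (simp only: xy4_pow) (simp add: x_pow_2 m_assoc)
  also have "y [^] ((4 - 16 * T) * (1 - 4 * T)) = y [^] (4::int)"
  proof (rule y_pow_eq)
    have "(4 - 16 * T) * (1 - 4 * T) - 4 = 32 * T * (2 * T - 1)"
      by (simp add: algebra_simps)
    then show "32 * t dvd (4 - 16 * T) * (1 - 4 * T) - 4" using T_cases by auto
  qed
  finally show ?thesis .
qed

text \<open>By \<open>yx2\<close>, y conjugates x^2 to x^(8t-2) y^(8T-4). The exponents are
  multiples of 2 and 4, so these factors commute and the l-th power distributes over them.\<close>

lemma y_x_even: "y \<otimes> x [^] (2 * l) = x [^] ((8 * t - 2) * l) \<otimes> y [^] ((8 * T - 4) * l + 1)" for l :: int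
proof -
  let ?a = "x [^] (8 * t - 2)" and ?b = "y [^] (8 * T - 4)"
  have "y \<otimes> x [^] (2::int) = ?a \<otimes> ?b \<otimes> y"
    by (simp add: yx2 y_mult_pow m_assoc)
  then have "y \<otimes> (x [^] (2::int)) [^] l = (?a \<otimes> ?b) [^] l \<otimes> y"
    by (intro semiconj_int_pow) simp_all
  also have "(?a \<otimes> ?b) [^] l = ?a [^] l \<otimes> ?b [^] l"
  proof (rule int_pow_mult_distrib)
    have "(x [^] (2::int)) [^] (4 * t - 1) \<otimes> (y [^] (4::int)) [^] (2 * T - 1)
        = (y [^] (4::int)) [^] (2 * T - 1) \<otimes> (x [^] (2::int)) [^] (4 * t - 1)"
      by (rule commute_int_pow) (simp_all add: x2_commute_y4)
    then show "?a \<otimes> ?b = ?b \<otimes> ?a"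
      by (simp add: int_pow_pow algebra_simps)
  qed simp_all
  finally show ?thesis
    by (simp add: int_pow_pow m_assoc y_mult_pow)
qed

text \<open>After the even part has passed, y x = x^-1 y^-1 handles the remaining x; the power of y
  in between is a power of y^4, which \<open>xy4_pow\<close> carries past x^-1.\<close>

lemma y_x_odd: "\<exists>(i::int) (j::int). y \<otimes> x [^] (2 * l + 1) = x [^] i \<otimes> y [^] j" for l :: int
proof -
  have inv_conj: "y [^] (4 * k) \<otimes> inv x = inv x \<otimes> y [^] ((4 - 16 * T) * k)" for k :: int
  proof -
    have "y [^] (4 * k) \<otimes> inv x = inv x \<otimes> (x \<otimes> y [^] (4 * k)) \<otimes> inv x"
      by (simp add: m_assoc[symmetric])
    then show ?thesis
      by (simp only: xy4_pow) (simp add: m_assoc)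
  qed
  have "y \<otimes> x [^] (2 * l + 1) = y \<otimes> x [^] (2 * l) \<otimes> x"
    by (simp add: m_assoc x_mult_pow)
  also have "\<dots> = x [^] ((8 * t - 2) * l) \<otimes> (y [^] ((8 * T - 4) * l) \<otimes> (y \<otimes> x))"
    by (simp add: y_x_even m_assoc int_pow_mult)
  also have "\<dots> = x [^] ((8 * t - 2) * l) \<otimes> (y [^] (4 * ((2 * T - 1) * l)) \<otimes> inv x) \<otimes> inv y"
    by (simp add: yx m_assoc algebra_simps)
  also have "\<dots> = x [^] ((8 * t - 2) * l) \<otimes> x [^] (-1::int)
      \<otimes> (y [^] ((4 - 16 * T) * ((2 * T - 1) * l)) \<otimes> y [^] (-1::int))"
    by (simp only: inv_conj) (simp add: m_assoc int_pow_neg)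
  finally show ?thesis
    unfolding int_pow_mult[OF x_closed, symmetric] int_pow_mult[OF y_closed, symmetric] by blast
qed

lemma y_x_pow: "\<exists>(i::int) (j::int). y \<otimes> x [^] k = x [^] i \<otimes> y [^] j" for k :: int
proof (cases "even k")
  case True
  then obtain l where "k = 2 * l" ..
  then show ?thesis by (metis y_x_even)
next
  case False
  then obtain l where "k = 2 * l + 1" ..
  then show ?thesis using y_x_odd by blast
qed

end


section \<open>Actions of a presented group\<close>

lemma inv_pres_class_letter:
  "inv\<^bsub>presented_group R\<^esub> (pres_class R [(g, True)]) = pres_class R [(g, False)]"
proof (rule group.inv_equality[OF group_presented_group])
  show "pres_class R [(g, False)] \<otimes>\<^bsub>presented_group R\<^esub> pres_class R [(g, True)]
      = \<one>\<^bsub>presented_group R\<^esub>"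
    using pres_eq.cancel[of R g False]
    by (simp add: mult_pres_class one_presented_group pres_class_eq_iff)
qed (simp_all add: carrier_presented_group)

lemma pres_class_replicate:
  "pres_class R (replicate n l) = pres_class R [l] [^]\<^bsub>presented_group R\<^esub> n"
proof (induction n)
  case 0
  show ?case by (simp add: one_presented_group)
next
  case (Suc n)
  have "pres_class R (replicate (Suc n) l) = pres_class R (replicate n l @ [l])"
    by (metis replicate_Suc replicate_append_same)
  then show ?case
    by (simp add: Suc mult_pres_class[symmetric])
qed

lemma pres_class_gpow:
  "pres_class R (gpow g k) = pres_class R [(g, True)] [^]\<^bsub>presented_group R\<^esub> k"
proof -
  interpret group "presented_group R" by (rule group_presented_group)
  have [simp]: "pres_class R w \<in> carrier (presented_group R)" for w
    by (simp add: carrier_presented_group)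
  show ?thesis
  proof (cases k rule: int_cases)
    case (nonneg n)
    then show ?thesis
      by (simp add: gpow_def pres_class_replicate int_pow_int)
  next
    case (neg n)
    then have "pres_class R (gpow g k) = pres_class R (replicate (Suc n) (g, False))"
      by (simp add: gpow_def nat_add_distrib)
    also have "\<dots> = inv\<^bsub>presented_group R\<^esub>
        (pres_class R [(g, True)] [^]\<^bsub>presented_group R\<^esub> Suc n)"
      unfolding pres_class_replicate by (subst nat_pow_inv[symmetric]) (simp_all only: inv_pres_class_letter, simp)
    finally show ?thesis
      using int_pow_neg_int[of "pres_class R [(g, True)]" "Suc n"] neg by simp
  qed
qed

fun word_act :: "('g \<Rightarrow> int \<Rightarrow> 'b \<Rightarrow> 'b) \<Rightarrow> 'g gword \<Rightarrow> 'b \<Rightarrow> 'b" where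
  "word_act A [] a = a"
| "word_act A ((g, b) # w) a = A g (if b then 1 else - 1) (word_act A w a)"

lemma word_act_append: "word_act A (u @ v) a = word_act A u (word_act A v a)"
  by (induction A u a rule: word_act.induct) auto

text \<open>\<open>A g k\<close> is the action of $g^k$ on the integers modulo \<open>N\<close>, given on representatives.\<close>

locale mod_action =
  fixes N :: int and A :: "'g \<Rightarrow> int \<Rightarrow> int \<Rightarrow> int"
  assumes cong: "a mod N = b mod N \<Longrightarrow> A g k a mod N = A g k b mod N"
    and add: "A g j (A g k a) mod N = A g (j + k) a mod N"
    and zero: "A g 0 a mod N = a mod N"
begin

lemma word_act_cong: "a mod N = b mod N \<Longrightarrow> word_act A u a mod N = word_act A u b mod N"
proof (induction u)
  case (Cons l u)
  then show ?case by (cases l) (auto intro: cong)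
qed simp

lemma word_act_replicate:
  "word_act A (replicate n (g, b)) a mod N = A g (if b then int n else - int n) a mod N"
proof (induction n)
  case 0
  then show ?case by (simp add: zero)
next
  case (Suc n)
  have "word_act A (replicate (Suc n) (g, b)) a mod N
      = A g (if b then 1 else - 1) (A g (if b then int n else - int n) a) mod N"
    using cong[OF Suc] by auto
  then show ?case
    by (auto simp: add)
qed

lemma word_act_gpow: "word_act A (gpow g k) a mod N = A g k a mod N"
  by (simp add: gpow_def word_act_replicate)

lemma word_act_gpow_append:
  "word_act A (gpow g k @ w) a mod N = A g k (word_act A w a) mod N"
  by (simp add: word_act_append word_act_gpow)

lemma word_act_gpow_append2:
  "word_act A (gpow g k @ gpow h l) a mod N = A g k (A h l a) mod N"
  unfolding word_act_gpow_append by (rule cong) (rule word_act_gpow)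

lemma pres_eq_word_act:
  assumes rels: "\<And>u v a. (u, v) \<in> R \<Longrightarrow> word_act A u a mod N = word_act A v a mod N"
    and "pres_eq R u v"
  shows "word_act A u a mod N = word_act A v a mod N"
  using assms(2)
proof (induction arbitrary: a rule: pres_eq.induct)
  case (cong u v x y)
  show ?case
    unfolding word_act_append by (rule word_act_cong) (rule cong.IH)
next
  case (cancel g b)
  have "A g j (A g (- j) a) mod N = a mod N" for j
    by (simp add: add zero)
  from this[of 1] this[of "- 1"] show ?case by auto
next
  case (relation u v)
  then show ?case by (rule rels)
qed simp_all

end

text \<open>The source of lower bounds: a word that is trivial in the group acts trivially in every
  model of the relations. As \<open>A\<close> gives powers in closed form, the symbolic exponents of
  the presentation need no iteration.\<close>

lemma Gamma_relations_mod_action: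
  assumes "mod_action N A"
    and rels: "\<And>a. A Sig1 p a mod N = a mod N"
      "\<And>a. A Sig2 q a mod N = a mod N"
      "\<And>a. A Sig1 1 (A Sig2 1 (A Sig1 1 (A Sig2 1 a))) mod N = a mod N"
      "\<And>a. A Sig2 (- 1) (A Sig1 1 a) mod N = A Sig1 i\<^sub>1 (A Sig2 j\<^sub>1 a) mod N"
      "\<And>a. A Sig2 1 (A Sig1 (- 1) a) mod N = A Sig1 i\<^sub>2 (A Sig2 j\<^sub>2 a) mod N"
    and eq: "pres_eq (Gamma_relations p q i\<^sub>1 j\<^sub>1 i\<^sub>2 j\<^sub>2) (gpow Sig1 i @ gpow Sig2 j) []"
  shows "A Sig1 i (A Sig2 j a) mod N = a mod N"
proof -
  interpret mod_action N A by fact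
  have involution: "word_act A (gpow Sig1 1 @ gpow Sig2 1 @ gpow Sig1 1 @ gpow Sig2 1) a mod N = a mod N" for a
    using rels(3) by (simp add: gpow_def)
  have "word_act A u a mod N = word_act A v a mod N"
    if "(u, v) \<in> Gamma_relations p q i\<^sub>1 j\<^sub>1 i\<^sub>2 j\<^sub>2" for u v a
    using that unfolding Gamma_relations_def insert_iff empty_iff prod.inject
    by (elim disjE conjE FalseE; hypsubst)
      (simp_all only: word_act_gpow word_act_gpow_append2 rels involution word_act.simps(1))
  from pres_eq_word_act[OF this eq, of a] show ?thesis
    by (simp add: word_act_gpow_append2)
qed


section \<open>The vertex and face actions\<close>

text \<open>Once parities are fixed, both actions are polynomial. Naming the quotient c of the
  difference by N turns each congruence below into a polynomial identity.\<close>

lemma mod_eqI: "a = b + N * c \<Longrightarrow> a mod N = b mod N" for a b c N :: int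
  by simp

lemma ex_half_int: "\<exists>l. a = 2 * l \<or> a = 2 * l + 1" for a :: int
  by (metis evenE oddE)

lemma even_mod_eqE:
  fixes a b N :: int
  assumes "even N" and "a mod N = b mod N"
  obtains c where "a = b + N * c" "even a \<longleftrightarrow> even b"
proof -
  obtain c where c: "a = b + N * c"
    using assms(2) by (metis mod_eqE)
  then have "even a \<longleftrightarrow> even b"
    using assms(1) by simp
  with c show ?thesis
    by (rule that)
qed

text \<open>The actions on the cosets of \<open>\<langle>\<sigma>\<^sub>2\<rangle>\<close> and \<open>\<langle>\<sigma>\<^sub>1\<rangle>\<close>, read off from the products
  $\sigma_2^k \sigma_1^a$ and $\sigma_1^k \sigma_2^b$ in normal form.\<close>

fun vertex_act :: "int \<Rightarrow> gen \<Rightarrow> int \<Rightarrow> int \<Rightarrow> int" where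
  "vertex_act t Sig1 k a = a + k"
| "vertex_act t Sig2 k a =
    (if even k then if even a then a else a - 4 * t * k
     else if even a then (4 * t - 1) * a else (4 * t - 1) * (a - 1) + 4 * t * (k - 1) - 1)"

fun face_act :: "int \<Rightarrow> gen \<Rightarrow> int \<Rightarrow> int \<Rightarrow> int" where
  "face_act T Sig1 k b =
    (if even b then (1 - 4 * k * T) * b
     else (1 + 4 * k * T) * (b - 1) - 2 * k - 4 * T * k * (k - 1) + 1)"
| "face_act T Sig2 k b = b + k"

lemma vertex_act_Sig2_add:
  "vertex_act t Sig2 j (vertex_act t Sig2 k a) mod (16 * t) = vertex_act t Sig2 (j + k) a mod (16 * t)"
proof -
  obtain j' where j: "j = 2 * j' \<or> j = 2 * j' + 1"
    using ex_half_int by blast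
  obtain k' where k: "k = 2 * k' \<or> k = 2 * k' + 1"
    using ex_half_int by blast
  obtain l where a: "a = 2 * l \<or> a = 2 * l + 1"
    using ex_half_int by blast
  let ?c = "if even j then if even k \<or> even a then 0 else - j'
    else if even k then if even a then 0 else - 2 * k' * t
    else if even a then 2 * l * t - l else 2 * l * t - l + 2 * k' * t + j'"
  show ?thesis
    using j k a by (intro mod_eqI[where c = ?c]; elim disjE) (simp_all add: algebra_simps)
qed

lemma face_act_Sig1_add:
  "face_act T Sig1 j (face_act T Sig1 k a) mod (32 * T) = face_act T Sig1 (j + k) a mod (32 * T)"
proof -
  obtain k' where k: "k = 2 * k' \<or> k = 2 * k' + 1"
    using ex_half_int by blast
  obtain l where a: "a = 2 * l \<or> a = 2 * l + 1"
    using ex_half_int by blast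
  let ?c = "T * j * (k * l - (if even a then 0 else if even k then 2 * k' * k' - k' else 2 * k' * k' + k'))"
  show ?thesis
    using k a by (intro mod_eqI[where c = ?c]; elim disjE) (simp_all add: algebra_simps)
qed

lemma mod_action_vertex_act: "mod_action (16 * t) (vertex_act t)"
proof
  fix a b k :: int and g :: gen
  assume ab: "a mod (16 * t) = b mod (16 * t)"
  have "even (16 * t)" by simp
  from this ab obtain c where c: "a = b + 16 * t * c" "even a \<longleftrightarrow> even b"
    by (rule even_mod_eqE)
  show "vertex_act t g k a mod (16 * t) = vertex_act t g k b mod (16 * t)"
  proof (cases g)
    case Sig1
    then show ?thesis using mod_add_cong[OF ab HOL.refl, of k] by simp
  next
    case Sig2
    with c show ?thesis
      by (intro mod_eqI[where c = "if even k then c else (4 * t - 1) * c"]) (auto simp: algebra_simps)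
  qed
next
  fix a j k :: int and g :: gen
  show "vertex_act t g j (vertex_act t g k a) mod (16 * t) = vertex_act t g (j + k) a mod (16 * t)"
    using vertex_act_Sig2_add by (cases g) (simp_all add: algebra_simps)
  show "vertex_act t g 0 a mod (16 * t) = a mod (16 * t)"
    by (cases g) simp_all
qed

lemma mod_action_face_act: "mod_action (32 * T) (face_act T)"
proof
  fix a b k :: int and g :: gen
  assume ab: "a mod (32 * T) = b mod (32 * T)"
  have "even (32 * T)" by simp
  from this ab obtain c where c: "a = b + 32 * T * c" "even a \<longleftrightarrow> even b"
    by (rule even_mod_eqE)
  show "face_act T g k a mod (32 * T) = face_act T g k b mod (32 * T)"
  proof (cases g)
    case Sig1
    with c show ?thesis
      by (intro mod_eqI[where c = "if even a then (1 - 4 * k * T) * c else (1 + 4 * k * T) * c"])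
        (auto simp: algebra_simps)
  next
    case Sig2
    then show ?thesis using mod_add_cong[OF ab HOL.refl, of k] by simp
  qed
next
  fix a j k :: int and g :: gen
  show "face_act T g j (face_act T g k a) mod (32 * T) = face_act T g (j + k) a mod (32 * T)"
    using face_act_Sig1_add by (cases g) (simp_all add: algebra_simps)
  show "face_act T g 0 a mod (32 * T) = a mod (32 * T)"
    by (cases g) simp_all
qed

lemma vertex_act_relations:
  fixes t T a :: int
  defines "A \<equiv> vertex_act t" and "N \<equiv> 16 * t"
  shows "A Sig1 (16 * t) a mod N = a mod N"
    and "A Sig2 (32 * t) a mod N = a mod N"
    and "A Sig1 1 (A Sig2 1 (A Sig1 1 (A Sig2 1 a))) mod N = a mod N"
    and "A Sig2 (- 1) (A Sig1 1 a) mod N = A Sig1 (8 * t - 1) (A Sig2 (8 * T - 3) a) mod N"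
    and "A Sig2 1 (A Sig1 (- 1) a) mod N = A Sig1 (1 - 8 * t) (A Sig2 (8 * T + 3) a) mod N"
proof -
  obtain l where a: "a = 2 * l \<or> a = 2 * l + 1"
    using ex_half_int by blast
  show "A Sig1 (16 * t) a mod N = a mod N"
    by (simp add: A_def N_def)
  show "A Sig2 (32 * t) a mod N = a mod N" unfolding A_def N_def
    by (rule mod_eqI[where c = "if even a then 0 else - 8 * t"]) simp
  show "A Sig1 1 (A Sig2 1 (A Sig1 1 (A Sig2 1 a))) mod N = a mod N" unfolding A_def N_def
    using a by (intro mod_eqI[where c = "2 * l * t - l"]; elim disjE) (simp_all add: algebra_simps)
  show "A Sig2 (- 1) (A Sig1 1 a) mod N = A Sig1 (8 * t - 1) (A Sig2 (8 * T - 3) a) mod N"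
    unfolding A_def N_def using a
    by (intro mod_eqI[where c = "if even a then - 1 else 1 - 2 * T"]; elim disjE)
      (simp_all add: algebra_simps)
  show "A Sig2 1 (A Sig1 (- 1) a) mod N = A Sig1 (1 - 8 * t) (A Sig2 (8 * T + 3) a) mod N"
    unfolding A_def N_def using a
    by (intro mod_eqI[where c = "if even a then 0 else - 2 * T"]; elim disjE)
      (simp_all add: algebra_simps)
qed

lemma face_act_relations:
  fixes t T a :: int
  assumes "T = t \<or> T = - t"
  defines "A \<equiv> face_act T" and "N \<equiv> 32 * T"
  shows "A Sig1 (16 * t) a mod N = a mod N"
    and "A Sig2 (32 * t) a mod N = a mod N"
    and "A Sig1 1 (A Sig2 1 (A Sig1 1 (A Sig2 1 a))) mod N = a mod N"
    and "A Sig2 (- 1) (A Sig1 1 a) mod N = A Sig1 (8 * t - 1) (A Sig2 (8 * T - 3) a) mod N"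
    and "A Sig2 1 (A Sig1 (- 1) a) mod N = A Sig1 (1 - 8 * t) (A Sig2 (8 * T + 3) a) mod N"
proof -
  obtain l where a: "a = 2 * l \<or> a = 2 * l + 1"
    using ex_half_int by blast
  \<comment> \<open>Treats both signs at once: c = 0 for T = t and c = -1 for T = -t. The goals
    become polynomial identities in T, c and l, with the quotients by 32T as witnesses.\<close>
  obtain c where t: "t = T + 2 * T * c"
    using assms(1) that[of 0] that[of "- 1"] by auto
  show "A Sig1 (16 * t) a mod N = a mod N" unfolding A_def N_def t
    using a by (intro mod_eqI[where c = "if even a then - 4 * T * l - 8 * T * c * l
      else 4 * T * l + 8 * T * c * l - 1 - 2 * c - 32 * T * T - 128 * T * T * c + 2 * T
        - 128 * T * T * c * c + 4 * T * c"]; elim disjE) (simp_all add: algebra_simps)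
  show "A Sig2 (32 * t) a mod N = a mod N" unfolding A_def N_def t
    by (rule mod_eqI[where c = "1 + 2 * c"]) (simp add: algebra_simps)
  show "A Sig1 1 (A Sig2 1 (A Sig1 1 (A Sig2 1 a))) mod N = a mod N" unfolding A_def N_def
    using a by (intro mod_eqI[where c = "if even a then - T * l else - T * l - T"]; elim disjE)
      (simp_all add: algebra_simps)
  show "A Sig2 (- 1) (A Sig1 1 a) mod N = A Sig1 (8 * t - 1) (A Sig2 (8 * T - 3) a) mod N"
    unfolding A_def N_def t using a
    by (intro mod_eqI[where c = "if even a then - 2 * T * l + 2 * T - 4 * T * c * l
        + 16 * T * T * c + 2 * T * c + c + 32 * T * T * c * c
      else 2 * T * l - 3 * T + 8 * T * T + 4 * T * c * l - 4 * T * c + 16 * T * T * c"]; elim disjE)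
      (simp_all add: algebra_simps)
  show "A Sig2 1 (A Sig1 (- 1) a) mod N = A Sig1 (1 - 8 * t) (A Sig2 (8 * T + 3) a) mod N"
    unfolding A_def N_def t using a
    by (intro mod_eqI[where c = "if even a then - 1 + 2 * T * l + 16 * T * T + 4 * T * c * l
        + 48 * T * T * c + 2 * T * c - c + 32 * T * T * c * c
      else - 3 * T - 2 * T * l - 8 * T * T - 4 * T * c * l - 8 * T * c - 16 * T * T * c"]; elim disjE)
      (simp_all add: algebra_simps)
qed

section \<open>The presented group as an exact product of cyclic groups\<close>

locale Gamma_tight =
  fixes t T :: int
  assumes T_cases: "T = t \<or> T = - t"
begin

abbreviation "rels \<equiv> Gamma_relations (16 * t) (32 * t) (8 * t - 1) (8 * T - 3) (1 - 8 * t) (8 * T + 3)"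

abbreviation "\<Gamma> \<equiv> presented_group rels"

abbreviation "\<sigma>\<^sub>1 \<equiv> pres_class rels [(Sig1, True)]"

abbreviation "\<sigma>\<^sub>2 \<equiv> pres_class rels [(Sig2, True)]"

sublocale group \<Gamma>
  by (rule group_presented_group)

lemma pres_class_closed [simp]: "pres_class rels w \<in> carrier \<Gamma>"
  by (simp add: carrier_presented_group)

lemma rels_pres_class: "(u, v) \<in> rels \<Longrightarrow> pres_class rels u = pres_class rels v"
  by (simp add: pres_class_eq_iff pres_eq.relation)

text \<open>On vertices, y^j fixes 0 and x^i sends 0 to i, so i is a multiple of 16t.\<close>

lemma pow_mult_pow_eq_one_imp_dvd:
  fixes i j :: int
  assumes "\<sigma>\<^sub>1 [^]\<^bsub>\<Gamma>\<^esub> i \<otimes>\<^bsub>\<Gamma>\<^esub> \<sigma>\<^sub>2 [^]\<^bsub>\<Gamma>\<^esub> j = \<one>\<^bsub>\<Gamma>\<^esub>"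
  shows "16 * t dvd i" "32 * t dvd j"
proof -
  have eq: "pres_eq rels (gpow Sig1 i @ gpow Sig2 j) []"
    using assms by (simp add: pres_class_gpow[symmetric] mult_pres_class one_presented_group
        pres_class_eq_iff)
  have "vertex_act t Sig1 i (vertex_act t Sig2 j 0) mod (16 * t) = 0 mod (16 * t)"
    by (rule Gamma_relations_mod_action[OF mod_action_vertex_act vertex_act_relations eq])
  then show i: "16 * t dvd i"
    by (simp add: mod_eq_0_iff_dvd split: if_splits)
  obtain k where k: "i = 16 * t * k"
    using i by blast
  \<comment> \<open>With 16t dividing i, x^i is already 1 in the group and acts trivially on faces.
    What remains is y^j, which moves the base face 0 to j.\<close>
  have x_trivial: "face_act T Sig1 i b mod (32 * T) = b mod (32 * T)" for b
  proof -
    have "\<sigma>\<^sub>1 [^]\<^bsub>\<Gamma>\<^esub> (16 * t) = \<one>\<^bsub>\<Gamma>\<^esub>"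
      using rels_pres_class[of "gpow Sig1 (16 * t)" "[]"]
      by (simp add: pres_class_gpow[symmetric] one_presented_group Gamma_relations_def)
    then have "\<sigma>\<^sub>1 [^]\<^bsub>\<Gamma>\<^esub> i \<otimes>\<^bsub>\<Gamma>\<^esub> \<sigma>\<^sub>2 [^]\<^bsub>\<Gamma>\<^esub> (0::int) = \<one>\<^bsub>\<Gamma>\<^esub>"
      using int_pow_pow[of "\<sigma>\<^sub>1" "16 * t" k] by (simp add: k)
    then have "pres_eq rels (gpow Sig1 i @ gpow Sig2 0) []"
      by (simp only: pres_class_gpow[symmetric] mult_pres_class one_presented_group
          pres_class_eq_iff)
    from Gamma_relations_mod_action[OF mod_action_face_act face_act_relations[OF T_cases] this, of b]
    show ?thesis by (simp only: face_act.simps(2) add_0_right)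
  qed
  have "face_act T Sig1 i (face_act T Sig2 j 0) mod (32 * T) = 0 mod (32 * T)"
    by (rule Gamma_relations_mod_action[OF mod_action_face_act face_act_relations[OF T_cases] eq])
  then have "32 * T dvd j"
    unfolding x_trivial by (simp add: mod_eq_0_iff_dvd)
  then show "32 * t dvd j"
    using T_cases by auto
qed

sublocale tight_relations \<Gamma> "\<sigma>\<^sub>1" "\<sigma>\<^sub>2" t T
proof
  show "T = t \<or> T = - t" by (rule T_cases)
  show "\<sigma>\<^sub>1 [^]\<^bsub>\<Gamma>\<^esub> (16 * t) = \<one>\<^bsub>\<Gamma>\<^esub>" "\<sigma>\<^sub>2 [^]\<^bsub>\<Gamma>\<^esub> (32 * t) = \<one>\<^bsub>\<Gamma>\<^esub>"
    unfolding pres_class_gpow[symmetric] one_presented_group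
    by (rule rels_pres_class, simp add: Gamma_relations_def)+
  have gpow_one: "gpow g 1 = [(g, True)]" "gpow g (- 1) = [(g, False)]" for g :: gen
    by (simp_all add: gpow_def)
  show "\<sigma>\<^sub>1 \<otimes>\<^bsub>\<Gamma>\<^esub> (\<sigma>\<^sub>2 \<otimes>\<^bsub>\<Gamma>\<^esub> (\<sigma>\<^sub>1 \<otimes>\<^bsub>\<Gamma>\<^esub> \<sigma>\<^sub>2)) = \<one>\<^bsub>\<Gamma>\<^esub>"
    unfolding mult_pres_class one_presented_group
    by (rule rels_pres_class) (simp add: Gamma_relations_def gpow_one)
  show "inv\<^bsub>\<Gamma>\<^esub> \<sigma>\<^sub>2 \<otimes>\<^bsub>\<Gamma>\<^esub> \<sigma>\<^sub>1 = \<sigma>\<^sub>1 [^]\<^bsub>\<Gamma>\<^esub> (8 * t - 1) \<otimes>\<^bsub>\<Gamma>\<^esub> \<sigma>\<^sub>2 [^]\<^bsub>\<Gamma>\<^esub> (8 * T - 3)"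
    unfolding pres_class_gpow[symmetric] mult_pres_class inv_pres_class_letter
    by (rule rels_pres_class) (simp add: Gamma_relations_def gpow_one)
  show "\<sigma>\<^sub>2 \<otimes>\<^bsub>\<Gamma>\<^esub> inv\<^bsub>\<Gamma>\<^esub> \<sigma>\<^sub>1 = \<sigma>\<^sub>1 [^]\<^bsub>\<Gamma>\<^esub> (1 - 8 * t) \<otimes>\<^bsub>\<Gamma>\<^esub> \<sigma>\<^sub>2 [^]\<^bsub>\<Gamma>\<^esub> (8 * T + 3)"
    unfolding pres_class_gpow[symmetric] mult_pres_class inv_pres_class_letter
    by (rule rels_pres_class) (simp add: Gamma_relations_def gpow_one)
qed simp_all

end

context tight_relations
begin

lemma y_left_closed:
  assumes "\<exists>(i::int) (j::int). g = x [^] i \<otimes> y [^] j"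
  shows "\<exists>(i::int) (j::int). y [^] (n::nat) \<otimes> g = x [^] i \<otimes> y [^] j"
proof (induction n)
  case 0
  have "g \<in> carrier G"
    using assms by auto
  with assms show ?case by simp
next
  case (Suc n)
  then obtain i j :: int where ij: "y [^] n \<otimes> g = x [^] i \<otimes> y [^] j"
    by blast
  obtain k l :: int where kl: "y \<otimes> x [^] i = x [^] k \<otimes> y [^] l"
    using y_x_pow by blast
  have [simp]: "g \<in> carrier G"
    using assms by auto
  have "y [^] Suc n \<otimes> g = y \<otimes> (y [^] n \<otimes> g)"
    by (simp only: nat_pow_Suc2 m_assoc y_closed nat_pow_closed \<open>g \<in> carrier G\<close>)
  also have "\<dots> = x [^] k \<otimes> y [^] (l + j)"
    by (simp add: ij m_assoc[symmetric] kl int_pow_mult)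
  finally show ?case
    by blast
qed

end

context Gamma_tight
begin

lemma product_of_int_powers:
  "\<exists>(i::int) (j::int). pres_class rels w = \<sigma>\<^sub>1 [^]\<^bsub>\<Gamma>\<^esub> i \<otimes>\<^bsub>\<Gamma>\<^esub> \<sigma>\<^sub>2 [^]\<^bsub>\<Gamma>\<^esub> j"
  if "t > 0"
proof (induction w)
  case Nil
  have "pres_class rels [] = \<sigma>\<^sub>1 [^]\<^bsub>\<Gamma>\<^esub> (0::int) \<otimes>\<^bsub>\<Gamma>\<^esub> \<sigma>\<^sub>2 [^]\<^bsub>\<Gamma>\<^esub> (0::int)"
    by (simp add: one_presented_group[symmetric])
  then show ?case by blast
next
  case (Cons l w)
  obtain s b where l: "l = (s, b)"
    by (cases l)
  have Cons_eq: "pres_class rels (l # w) = pres_class rels [l] \<otimes>\<^bsub>\<Gamma>\<^esub> pres_class rels w"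
    by (simp add: mult_pres_class)
  obtain i j :: int where ij: "pres_class rels w = \<sigma>\<^sub>1 [^]\<^bsub>\<Gamma>\<^esub> i \<otimes>\<^bsub>\<Gamma>\<^esub> \<sigma>\<^sub>2 [^]\<^bsub>\<Gamma>\<^esub> j"
    using Cons by blast
  show ?case
  proof (cases s)
    case Sig1
    have "pres_class rels [l] = \<sigma>\<^sub>1 [^]\<^bsub>\<Gamma>\<^esub> (if b then 1 else - 1 :: int)"
      unfolding pres_class_gpow[symmetric] by (simp add: gpow_def l Sig1)
    then have "pres_class rels (l # w) = \<sigma>\<^sub>1 [^]\<^bsub>\<Gamma>\<^esub> ((if b then 1 else - 1) + i) \<otimes>\<^bsub>\<Gamma>\<^esub> \<sigma>\<^sub>2 [^]\<^bsub>\<Gamma>\<^esub> j"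
      by (simp only: Cons_eq ij x_pow_mult int_pow_closed pres_class_closed)
    then show ?thesis by blast
  next
    case Sig2
    have "pres_class rels [l] = \<sigma>\<^sub>2 [^]\<^bsub>\<Gamma>\<^esub> (if b then 1 else - 1 :: int)"
      unfolding pres_class_gpow[symmetric] by (simp add: gpow_def l Sig2)
    \<comment> \<open>\<open>y_left_closed\<close> covers natural exponents only, so y^-1 is
      replaced by y^(32t-1).\<close>
    also have "\<dots> = \<sigma>\<^sub>2 [^]\<^bsub>\<Gamma>\<^esub> (if b then 1 else 32 * t - 1)"
      by (rule y_pow_eq) simp
    also have "\<dots> = \<sigma>\<^sub>2 [^]\<^bsub>\<Gamma>\<^esub> nat (if b then 1 else 32 * t - 1)"
      using \<open>t > 0\<close> by (simp only: int_pow_int[symmetric]) simp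
    finally show ?thesis
      using y_left_closed[OF Cons] by (simp add: Cons_eq)
  qed
qed

lemma no_inverting_hom:
  assumes "t > 0"
  shows "\<not> (\<exists>\<phi>\<in>hom \<Gamma> \<Gamma>. \<phi> \<sigma>\<^sub>1 = inv\<^bsub>\<Gamma>\<^esub> \<sigma>\<^sub>1 \<and> \<phi> \<sigma>\<^sub>2 = inv\<^bsub>\<Gamma>\<^esub> \<sigma>\<^sub>2)"
proof
  assume "\<exists>\<phi>\<in>hom \<Gamma> \<Gamma>. \<phi> \<sigma>\<^sub>1 = inv\<^bsub>\<Gamma>\<^esub> \<sigma>\<^sub>1 \<and> \<phi> \<sigma>\<^sub>2 = inv\<^bsub>\<Gamma>\<^esub> \<sigma>\<^sub>2"
  then obtain \<phi> where "\<phi> \<in> hom \<Gamma> \<Gamma>"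
    and \<phi>: "\<phi> \<sigma>\<^sub>1 = inv\<^bsub>\<Gamma>\<^esub> \<sigma>\<^sub>1" "\<phi> \<sigma>\<^sub>2 = inv\<^bsub>\<Gamma>\<^esub> \<sigma>\<^sub>2"
    by blast
  then interpret \<phi>: group_hom \<Gamma> \<Gamma> \<phi>
    by unfold_locales
  have pow: "\<phi> (\<sigma>\<^sub>1 [^]\<^bsub>\<Gamma>\<^esub> k) = \<sigma>\<^sub>1 [^]\<^bsub>\<Gamma>\<^esub> (- k)" "\<phi> (\<sigma>\<^sub>2 [^]\<^bsub>\<Gamma>\<^esub> k) = \<sigma>\<^sub>2 [^]\<^bsub>\<Gamma>\<^esub> (- k)" for k :: int
    by (simp_all add: \<phi>.hom_int_pow \<phi> int_pow_inv int_pow_neg)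
  have "\<sigma>\<^sub>2 \<otimes>\<^bsub>\<Gamma>\<^esub> inv\<^bsub>\<Gamma>\<^esub> \<sigma>\<^sub>1 = \<phi> (inv\<^bsub>\<Gamma>\<^esub> \<sigma>\<^sub>2 \<otimes>\<^bsub>\<Gamma>\<^esub> \<sigma>\<^sub>1)"
    by (simp add: \<phi>)
  also have "\<dots> = \<sigma>\<^sub>1 [^]\<^bsub>\<Gamma>\<^esub> (1 - 8 * t) \<otimes>\<^bsub>\<Gamma>\<^esub> \<sigma>\<^sub>2 [^]\<^bsub>\<Gamma>\<^esub> (3 - 8 * T)"
    by (simp add: rel1 pow)
  finally have eq: "\<sigma>\<^sub>2 [^]\<^bsub>\<Gamma>\<^esub> (8 * T + 3) = \<sigma>\<^sub>2 [^]\<^bsub>\<Gamma>\<^esub> (3 - 8 * T)"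
    by (simp add: rel2)
  have "\<sigma>\<^sub>1 [^]\<^bsub>\<Gamma>\<^esub> (0::int) \<otimes>\<^bsub>\<Gamma>\<^esub> \<sigma>\<^sub>2 [^]\<^bsub>\<Gamma>\<^esub> ((8 * T + 3) - (3 - 8 * T)) = \<one>\<^bsub>\<Gamma>\<^esub>"
    using eq int_pow_diff[of "\<sigma>\<^sub>2" "8 * T + 3" "3 - 8 * T"] by simp
  from pow_mult_pow_eq_one_imp_dvd(2)[OF this] have "32 * t dvd 16 * T"
    by simp
  then have "32 * t dvd 16 * t"
    using T_cases by auto
  then show False
    using assms zdvd_imp_le[of "32 * t" "16 * t"] by simp
qed

lemma x_pow_eq_one_iff: "\<sigma>\<^sub>1 [^]\<^bsub>\<Gamma>\<^esub> i = \<one>\<^bsub>\<Gamma>\<^esub> \<longleftrightarrow> 16 * t dvd i" for i :: int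
proof
  show "\<sigma>\<^sub>1 [^]\<^bsub>\<Gamma>\<^esub> i = \<one>\<^bsub>\<Gamma>\<^esub>" if "16 * t dvd i"
    using x_pow_eq[of i 0] that by (simp only: diff_zero int_pow_0)
  show "16 * t dvd i" if "\<sigma>\<^sub>1 [^]\<^bsub>\<Gamma>\<^esub> i = \<one>\<^bsub>\<Gamma>\<^esub>"
    using that by (intro pow_mult_pow_eq_one_imp_dvd(1)[of i 0]) simp
qed

lemma y_pow_eq_one_iff: "\<sigma>\<^sub>2 [^]\<^bsub>\<Gamma>\<^esub> i = \<one>\<^bsub>\<Gamma>\<^esub> \<longleftrightarrow> 32 * t dvd i" for i :: int
proof
  show "\<sigma>\<^sub>2 [^]\<^bsub>\<Gamma>\<^esub> i = \<one>\<^bsub>\<Gamma>\<^esub>" if "32 * t dvd i"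
    using y_pow_eq[of i 0] that by (simp only: diff_zero int_pow_0)
  show "32 * t dvd i" if "\<sigma>\<^sub>2 [^]\<^bsub>\<Gamma>\<^esub> i = \<one>\<^bsub>\<Gamma>\<^esub>"
    using that by (intro pow_mult_pow_eq_one_imp_dvd(2)[of 0 i]) simp
qed

lemma powers_inter:
  fixes i j :: int
  assumes "\<sigma>\<^sub>1 [^]\<^bsub>\<Gamma>\<^esub> i = \<sigma>\<^sub>2 [^]\<^bsub>\<Gamma>\<^esub> j"
  shows "\<sigma>\<^sub>1 [^]\<^bsub>\<Gamma>\<^esub> i = \<one>\<^bsub>\<Gamma>\<^esub>"
  unfolding x_pow_eq_one_iff
proof (rule pow_mult_pow_eq_one_imp_dvd(1))
  show "\<sigma>\<^sub>1 [^]\<^bsub>\<Gamma>\<^esub> i \<otimes>\<^bsub>\<Gamma>\<^esub> \<sigma>\<^sub>2 [^]\<^bsub>\<Gamma>\<^esub> (- j) = \<one>\<^bsub>\<Gamma>\<^esub>"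
    by (simp add: assms int_pow_neg)
qed

lemma product_of_nat_powers:
  assumes "g \<in> carrier \<Gamma>" and t: "t > 0"
  shows "\<exists>i j. g = \<sigma>\<^sub>1 [^]\<^bsub>\<Gamma>\<^esub> (i::nat) \<otimes>\<^bsub>\<Gamma>\<^esub> \<sigma>\<^sub>2 [^]\<^bsub>\<Gamma>\<^esub> (j::nat)"
proof -
  obtain w where w: "g = pres_class rels w"
    using assms(1) unfolding carrier_presented_group by blast
  obtain i j :: int where "g = \<sigma>\<^sub>1 [^]\<^bsub>\<Gamma>\<^esub> i \<otimes>\<^bsub>\<Gamma>\<^esub> \<sigma>\<^sub>2 [^]\<^bsub>\<Gamma>\<^esub> j"
    using product_of_int_powers[OF t, of w] unfolding w by blast
  moreover have "\<sigma>\<^sub>1 [^]\<^bsub>\<Gamma>\<^esub> i = \<sigma>\<^sub>1 [^]\<^bsub>\<Gamma>\<^esub> int (nat (i mod (16 * t)))"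
    using t by (intro x_pow_eq) (simp add: minus_mod_eq_mult_div)
  moreover have "\<sigma>\<^sub>2 [^]\<^bsub>\<Gamma>\<^esub> j = \<sigma>\<^sub>2 [^]\<^bsub>\<Gamma>\<^esub> int (nat (j mod (32 * t)))"
    using t by (intro y_pow_eq) (simp add: minus_mod_eq_mult_div)
  ultimately have "g = \<sigma>\<^sub>1 [^]\<^bsub>\<Gamma>\<^esub> nat (i mod (16 * t)) \<otimes>\<^bsub>\<Gamma>\<^esub> \<sigma>\<^sub>2 [^]\<^bsub>\<Gamma>\<^esub> nat (j mod (32 * t))"
    by (simp only: int_pow_int)
  then show ?thesis
    by blast
qed

lemma tight_generators_Gamma:
  assumes t: "t = int n" and n: "n > 0"
  shows "tight_generators \<Gamma> \<sigma>\<^sub>1 \<sigma>\<^sub>2 (16 * n) (32 * n)"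
proof (intro tight_generators.intro tight_generators_axioms.intro)
  have ints: "16 * t = int (16 * n)" "32 * t = int (32 * n)"
    by (simp_all add: t)
  show "\<sigma>\<^sub>1 [^]\<^bsub>\<Gamma>\<^esub> i = \<one>\<^bsub>\<Gamma>\<^esub> \<longleftrightarrow> 16 * n dvd i" for i :: nat
    using x_pow_eq_one_iff[of "int i"] unfolding int_pow_int ints int_dvd_int_iff .
  show "\<sigma>\<^sub>2 [^]\<^bsub>\<Gamma>\<^esub> i = \<one>\<^bsub>\<Gamma>\<^esub> \<longleftrightarrow> 32 * n dvd i" for i :: nat
    using y_pow_eq_one_iff[of "int i"] unfolding int_pow_int ints int_dvd_int_iff .
  show "\<sigma>\<^sub>1 [^]\<^bsub>\<Gamma>\<^esub> i = \<one>\<^bsub>\<Gamma>\<^esub>" if "\<sigma>\<^sub>1 [^]\<^bsub>\<Gamma>\<^esub> i = \<sigma>\<^sub>2 [^]\<^bsub>\<Gamma>\<^esub> j" for i j :: nat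
    using powers_inter[of "int i" "int j"] that unfolding int_pow_int .
  show "\<exists>i j. g = \<sigma>\<^sub>1 [^]\<^bsub>\<Gamma>\<^esub> (i::nat) \<otimes>\<^bsub>\<Gamma>\<^esub> \<sigma>\<^sub>2 [^]\<^bsub>\<Gamma>\<^esub> (j::nat)" if "g \<in> carrier \<Gamma>" for g
    using that t n by (intro product_of_nat_powers) simp_all
  show "\<sigma>\<^sub>2 \<otimes>\<^bsub>\<Gamma>\<^esub> \<sigma>\<^sub>1 = inv\<^bsub>\<Gamma>\<^esub> \<sigma>\<^sub>1 \<otimes>\<^bsub>\<Gamma>\<^esub> inv\<^bsub>\<Gamma>\<^esub> \<sigma>\<^sub>2"
    by (rule yx)
  show "16 * n > 1" "32 * n > 1"
    using n by simp_all
  show "group \<Gamma>"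
    by (rule is_group)
qed (rule pres_class_closed)+

lemma Gamma_tight_chiral:
  assumes t: "t = int n" and n: "n > 0"
  shows "Gamma_is_aut_group_of_tight_chiral (16 * n) (32 * n)
    (8 * t - 1) (8 * T - 3) (1 - 8 * t) (8 * T + 3)"
proof -
  interpret gens: tight_generators \<Gamma> "\<sigma>\<^sub>1" "\<sigma>\<^sub>2" "16 * n" "32 * n"
    using t n by (rule tight_generators_Gamma)
  have "int (16 * n) = 16 * t" "int (32 * n) = 32 * t"
    by (simp_all add: t)
  then show ?thesis
    unfolding Gamma_is_aut_group_of_tight_chiral_def Gamma_def Gamma_gen_def
    using gens.coset_polyhedron_exists no_inverting_hom n t by simp
qed

end

theorem theorem3p8:
  fixes \<beta> :: nat
  assumes "\<beta> \<ge> 5"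
  shows "Gamma_is_aut_group_of_tight_chiral (2 ^ (\<beta> - 1)) (2 ^ \<beta>)
           (- 1 + 2 ^ (\<beta> - 2)) (- 3 + 2 ^ (\<beta> - 2)) (1 - 2 ^ (\<beta> - 2)) (3 + 2 ^ (\<beta> - 2)) \<and>
         Gamma_is_aut_group_of_tight_chiral (2 ^ (\<beta> - 1)) (2 ^ \<beta>)
           (- 1 + 2 ^ (\<beta> - 2)) (- 3 - 2 ^ (\<beta> - 2)) (1 - 2 ^ (\<beta> - 2)) (3 - 2 ^ (\<beta> - 2))"
proof -
  obtain k where k: "\<beta> = k + 5"
    using assms by (metis le_add_diff_inverse2)
  define n :: nat where "n = 2 ^ k"
  have "\<beta> - 1 = k + 4" "\<beta> - 2 = k + 3"
    by (simp_all add: k)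
  then have pows: "2 ^ (\<beta> - 1) = 16 * n" "2 ^ \<beta> = 32 * n" "2 ^ (\<beta> - 2) = 8 * int n"
    by (simp_all only: k n_def power_add) simp_all
  \<comment> \<open>The two groups differ only in the sign of T, with t = n =
    2^(\<open>\<beta>\<close> - 5) in both.\<close>
  interpret pos: Gamma_tight "int n" "int n"
    by unfold_locales simp
  interpret neg: Gamma_tight "int n" "- int n"
    by unfold_locales simp
  have "n > 0"
    by (simp add: n_def)
  then show ?thesis
    using pos.Gamma_tight_chiral[of n] neg.Gamma_tight_chiral[of n]
    unfolding pows by (simp add: add.commute minus_diff_commute)
qed

end
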